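(* Let $\beta>0$ and $\delta>0$. Suppose that the stochastic process $\boldsymbol{X}=(X_t)_{t\in[0,1]}$, with sample paths in $\bar C^-[0,1]=\{f\in C[0,1]: f\le 0\}$, satisfies the following condition: for some $\varepsilon_0>0$ there are a function $K:\bar E^-[0,1]\to\mathbb{R}$ and a remainder $r(c,f)$ with $r(c,f)=o(c^\delta)$ as $c\to 0$ such that $$P(\boldsymbol{X}>cf)=P(\boldsymbol{V}>cf)\left(1+c^\delta K(f)+r(c,f)\right)$$ for all $c\in(0,1)$ and all $f\in\bar E^-[0,1]$ with $\|f\|_\infty\le\varepsilon_0$, where $\boldsymbol{V}$ is a standard generalized Pareto process corresponding to $\beta$ and $\psi$ (see context). Let $\boldsymbol{X}^{(1)},\boldsymbol{X}^{(2)},\dots$ be independent copies of $\boldsymbol{X}$ and, for $c<0$, put $$\widehat\Psi_{c,n}:=\frac{1}{2|c|n}\sum_{i=1}^n 1\left(X^{(i)}_t>c\text{ for all }t\in[0,1]\right),\qquad \widehat\beta_{c,n}:=-2\Psi^{-1}\left(\widehat\Psi_{c,n}\right).$$ If the sequence of thresholds $c_n<0$, $n\in\mathbb{N}$, satisfies $c_n\to 0$, $n|c_n|\to\infty$ and $n|c_n|^{1+2\delta}\to\mathrm{const}\ge 0$ (a finite constant) as $n\to\infty$, then, with $\mu:=K(-1)\Psi(-\beta/2)$, where $-1$ denotes the constant function $-1$: (i) $$(n|c_n|)^{1/2}\left(\widehat\Psi_{c_n,n}-\Psi\left(-\tfrac{\beta}{2}\right)\right)\to_D N\left(\mathrm{const}^{1/2}\mu,\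 \tfrac12\Psi\left(-\tfrac{\beta}{2}\right)\right),$$ (ii) $$(n|c_n|)^{1/2}\left(\widehat\beta_{c_n,n}-\beta\right)\to_D N\left(-\frac{2\,\mathrm{const}^{1/2}\mu}{\psi\left(-\frac{\beta}{2}\right)},\ \frac{2\Psi\left(-\frac{\beta}{2}\right)}{\psi^2\left(-\frac{\beta}{2}\right)}\right).$$
   Context: $\psi$ is a known continuous probability density on $\mathbb{R}$ with $\psi(s)=\psi(-s)>0$ for all $s$ and $\psi(s)$, $s\ge 0$, decreasing; $\Psi(x)=\int_{-\infty}^x\psi(s)\,ds$, and $\Psi^{-1}(q)=\inf\{t\in\mathbb{R}:\Psi(t)\ge q\}$ for $q\in(0,1)$. The value assigned to $\widehat\beta_{c,n}$ when $\widehat\Psi_{c,n}\notin(0,1)$ is immaterial. $\psi_\beta(s):=\beta\psi(\beta s)$. $\bar E^-[0,1]$ is the set of bounded functions $f:[0,1]\to(-\infty,0]$ with a finite set of discontinuities; $\|f\|_\infty=\sup_{t\in[0,1]}|f(t)|$. Inequalities between functions (such as $\boldsymbol{X}>cf$) are pointwise for all $t\in[0,1]$. A standard extreme value process (EVP) is a process $\boldsymbol{\eta}=(\eta_t)_{t\in[0,1]}$ with sample paths in $C[0,1]$, with $P(\eta_t\le x)=e^x$ for $x\le 0$, $t\in[0,1]$, and $P(\boldsymbol{\eta}\le f/n)^n=P(\boldsymbol{\eta}\le f)$ for all $f\in\bar E^-[0,1]$, $n\in\mathbb{N}$. The EVP with parameter $\beta$ has the finite dimensional distributions $$P(\eta_{t_j}\le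 x_j,\,1\le j\le d)=\exp\left(-\int_{-\infty}^\infty\max_{j\le d}\left(|x_j|\psi_\beta(s-t_j)\right)ds\right),\quad x_j\le 0,\ t_j\in[0,1],\ d\in\mathbb{N}.$$ A standard generalized Pareto process (GPP) corresponding to $\beta$ and $\psi$ is a process $\boldsymbol{V}$ with sample paths in $C[0,1]$ for which there is $x_0>0$ with $P(\boldsymbol{V}\le f)=1+\log P(\boldsymbol{\eta}\le f)=1-\int_{-\infty}^\infty\sup_{t\in[0,1]}(|f(t)|\psi(s-\beta t))\,ds$ for all $f\in\bar E^-[0,1]$ with $\|f\|_\infty\le x_0$, where $\boldsymbol{\eta}$ is this EVP. $\to_D$ denotes convergence in distribution as $n\to\infty$, $N(a,b)$ the normal distribution with mean $a$ and variance $b$.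
   Formalization: If ε0<1, the condition on X leaves K(−1) unconstrained, so the claim fails as stated (X=V, K=0 on the ball, K(−1)=1, const>0). The formal theorem adds, for ε0<1 only, the hypothesis K(−ε0)=ε0^δ K(−1). *)

theory Defs
  imports "HOL-Probability.Probability" "HOL-Library.Landau_Symbols"
begin

subsection \<open>Function spaces on the unit interval\<close>

text \<open>
  Functions on \<open>[0,1]\<close> are rendered as functions of type \<open>real \<Rightarrow> real\<close> whose values
  outside \<open>[0,1]\<close> play no role.
\<close>

definition C01 :: "(real \<Rightarrow> real) set" where
  "C01 = {f. continuous_on {0..1} f}"

definition Cbar_minus :: "(real \<Rightarrow> real) set" where
  "Cbar_minus = {f \<in> C01. \<forall>t\<in>{0..1}. f t \<le> 0}"

definition Ebar_minus :: "(real \<Rightarrow> real) set" where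
  "Ebar_minus = {f. bounded (f ` {0..1}) \<and> (\<forall>t\<in>{0..1}. f t \<le> 0) \<and>
     finite {t \<in> {0..1}. \<not> continuous (at t within {0..1}) f}}"

definition sup_norm01 :: "(real \<Rightarrow> real) \<Rightarrow> real" where
  "sup_norm01 f = (SUP t\<in>{0..1}. \<bar>f t\<bar>)"

subsection \<open>Stochastic processes indexed by the unit interval\<close>

definition process_with_paths_in ::
  "(real \<Rightarrow> real) set \<Rightarrow> 'a measure \<Rightarrow> (real \<Rightarrow> 'a \<Rightarrow> real) \<Rightarrow> bool" where
  "process_with_paths_in S M X \<longleftrightarrow> prob_space M \<and>
     (\<forall>t\<in>{0..1}. X t \<in> borel_measurable M) \<and> (\<forall>\<omega>\<in>space M. (\<lambda>t. X t \<omega>) \<in> S)"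

definition prob_le :: "'a measure \<Rightarrow> (real \<Rightarrow> 'a \<Rightarrow> real) \<Rightarrow> (real \<Rightarrow> real) \<Rightarrow> real" where
  "prob_le M X f = measure M {\<omega> \<in> space M. \<forall>t\<in>{0..1}. X t \<omega> \<le> f t}"

definition prob_gt :: "'a measure \<Rightarrow> (real \<Rightarrow> 'a \<Rightarrow> real) \<Rightarrow> (real \<Rightarrow> real) \<Rightarrow> real" where
  "prob_gt M X f = measure M {\<omega> \<in> space M. \<forall>t\<in>{0..1}. X t \<omega> > f t}"

abbreviation path_space :: "(real \<Rightarrow> real) measure" where
  "path_space \<equiv> PiM {0..1} (\<lambda>_. borel)"

definition path :: "(real \<Rightarrow> 'a \<Rightarrow> real) \<Rightarrow> 'a \<Rightarrow> real \<Rightarrow> real" where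
  "path X \<omega> = restrict (\<lambda>t. X t \<omega>) {0..1}"

text \<open>The copies are numbered from 1.\<close>

definition independent_copies ::
  "(real \<Rightarrow> real) set \<Rightarrow> 'a measure \<Rightarrow> (real \<Rightarrow> 'a \<Rightarrow> real) \<Rightarrow>
   'b measure \<Rightarrow> (nat \<Rightarrow> real \<Rightarrow> 'b \<Rightarrow> real) \<Rightarrow> bool" where
  "independent_copies S M X N Xs \<longleftrightarrow>
     (\<forall>i\<ge>1. process_with_paths_in S N (Xs i) \<and>
        distr N path_space (path (Xs i)) = distr M path_space (path X)) \<and>
     prob_space.indep_vars N (\<lambda>_. path_space) (\<lambda>i. path (Xs i)) {1..}"

subsection \<open>The density, its distribution function and its quantile function\<close>

definition admissible_density :: "(real \<Rightarrow> real) \<Rightarrow> bool" where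
  "admissible_density \<psi> \<longleftrightarrow>
     continuous_on UNIV \<psi> \<and> has_bochner_integral lborel \<psi> 1 \<and>
     (\<forall>s. \<psi> s = \<psi> (- s) \<and> \<psi> s > 0) \<and> antimono_on {0..} \<psi>"

definition dist_fun :: "(real \<Rightarrow> real) \<Rightarrow> real \<Rightarrow> real" where
  "dist_fun \<psi> x = (LINT s:{..x}|lborel. \<psi> s)"

definition quantile_fun :: "(real \<Rightarrow> real) \<Rightarrow> real \<Rightarrow> real" where
  "quantile_fun \<psi> q = Inf {t. dist_fun \<psi> t \<ge> q}"

definition scaled_density :: "real \<Rightarrow> (real \<Rightarrow> real) \<Rightarrow> real \<Rightarrow> real" where
  "scaled_density \<beta> \<psi> s = \<beta> * \<psi> (\<beta> * s)"

subsection \<open>Extreme value processes and generalized Pareto processes\<close>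

definition standard_EVP :: "'a measure \<Rightarrow> (real \<Rightarrow> 'a \<Rightarrow> real) \<Rightarrow> bool" where
  "standard_EVP M \<eta> \<longleftrightarrow> process_with_paths_in C01 M \<eta> \<and>
     (\<forall>t\<in>{0..1}. \<forall>x\<le>0. measure M {\<omega> \<in> space M. \<eta> t \<omega> \<le> x} = exp x) \<and>
     (\<forall>f\<in>Ebar_minus. \<forall>n\<ge>1. prob_le M \<eta> (\<lambda>t. f t / real n) ^ n = prob_le M \<eta> f)"

definition EVP_with_parameter ::
  "real \<Rightarrow> (real \<Rightarrow> real) \<Rightarrow> 'a measure \<Rightarrow> (real \<Rightarrow> 'a \<Rightarrow> real) \<Rightarrow> bool" where
  "EVP_with_parameter \<beta> \<psi> M \<eta> \<longleftrightarrow> standard_EVP M \<eta> \<and>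
     (\<forall>d\<ge>1. \<forall>x t :: nat \<Rightarrow> real. (\<forall>j\<in>{1..d}. x j \<le> 0 \<and> t j \<in> {0..1}) \<longrightarrow>
        measure M {\<omega> \<in> space M. \<forall>j\<in>{1..d}. \<eta> (t j) \<omega> \<le> x j} =
        exp (- (LINT s|lborel. Max ((\<lambda>j. \<bar>x j\<bar> * scaled_density \<beta> \<psi> (s - t j)) ` {1..d}))))"

text \<open>
  \<open>\<eta>\<close> is intended to be an EVP with parameter \<open>\<beta>\<close>; it may live on a probability space
  different from that of \<open>V\<close>, since only its distribution enters.
\<close>

definition standard_GPP ::
  "real \<Rightarrow> (real \<Rightarrow> real) \<Rightarrow> 'a measure \<Rightarrow> (real \<Rightarrow> 'a \<Rightarrow> real) \<Rightarrow>
   'b measure \<Rightarrow> (real \<Rightarrow> 'b \<Rightarrow> real) \<Rightarrow> bool" where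
  "standard_GPP \<beta> \<psi> M \<eta> N V \<longleftrightarrow> process_with_paths_in C01 N V \<and>
     (\<exists>x0>0. \<forall>f\<in>Ebar_minus. sup_norm01 f \<le> x0 \<longrightarrow>
        prob_le N V f = 1 + ln (prob_le M \<eta> f) \<and>
        prob_le N V f = 1 - (LINT s|lborel. (SUP t\<in>{0..1}. \<bar>f t\<bar> * \<psi> (s - \<beta> * t))))"

subsection \<open>The estimators\<close>

definition Psi_hat :: "(nat \<Rightarrow> real \<Rightarrow> 'a \<Rightarrow> real) \<Rightarrow> real \<Rightarrow> nat \<Rightarrow> 'a \<Rightarrow> real" where
  "Psi_hat Xs c n \<omega> =
     1 / (2 * \<bar>c\<bar> * real n) * (\<Sum>i=1..n. of_bool (\<forall>t\<in>{0..1}. Xs i t \<omega> > c))"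

text \<open>
  \<open>v c n q\<close> is the immaterial value assigned to the estimator when \<open>q = Psi_hat Xs c n \<omega>\<close>
  is not in \<open>(0,1)\<close>.
\<close>

definition beta_hat ::
  "(real \<Rightarrow> nat \<Rightarrow> real \<Rightarrow> real) \<Rightarrow> (real \<Rightarrow> real) \<Rightarrow> (nat \<Rightarrow> real \<Rightarrow> 'a \<Rightarrow> real) \<Rightarrow>
   real \<Rightarrow> nat \<Rightarrow> 'a \<Rightarrow> real" where
  "beta_hat v \<psi> Xs c n \<omega> =
     (let q = Psi_hat Xs c n \<omega> in
      if q \<in> {0<..<1} then - 2 * quantile_fun \<psi> q else v c n q)"

subsection \<open>Convergence in distribution to a normal law\<close>

text \<open>The second parameter is the variance; it is positive wherever this is used.\<close>

definition normal_law :: "real \<Rightarrow> real \<Rightarrow> real measure" where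
  "normal_law a b = density lborel (\<lambda>x. ennreal (normal_density a (sqrt b) x))"

definition converges_in_distribution ::
  "'a measure \<Rightarrow> (nat \<Rightarrow> 'a \<Rightarrow> real) \<Rightarrow> real measure \<Rightarrow> bool" where
  "converges_in_distribution M T L \<longleftrightarrow>
     (\<forall>n\<ge>1. T n \<in> borel_measurable M) \<and> weak_conv_m (\<lambda>n. distr M borel (T n)) L"

end

theory Submission
  imports Defs
begin

text \<open>
  For small \<open>c < 0\<close> one has exactly \<open>P(V > c) = 2 \<bar>c\<bar> \<Psi>(- \<beta> / 2)\<close>: testing the
  distribution of \<open>V\<close> with functions vanishing off a finite set and using inclusion--exclusion,
  \<open>P(V > c on T) = \<bar>c\<bar> \<integral> min {\<psi>(s - \<beta> t) | t \<in> T} ds\<close> for finite \<open>T \<supseteq> {0, 1}\<close>, and by symmetry and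
  unimodality of \<open>\<psi>\<close> the minimum is attained at \<open>t = 0\<close> or \<open>t = 1\<close>. Hence the number of
  exceedances is binomial with success probability
  \<open>2 \<bar>c\<bar> \<Psi>(- \<beta> / 2) (1 + \<bar>c\<bar>\<^sup>\<delta> K(-1) + o(\<bar>c\<bar>\<^sup>\<delta>))\<close>, and the central limit theorem for triangular
  Bernoulli arrays gives (i), the second order term producing the bias. For (ii) the distribution
  function of the estimator of \<open>\<beta>\<close> is rewritten through \<open>\<Psi>\<close>, which is differentiable with
  derivative \<open>\<psi>\<close>.
\<close>

subsection \<open>Unimodal densities and their quantiles\<close>

text \<open>Evenness lets both arguments be replaced by their absolute values. In this form symmetry
  and monotonicity together say that the density decreases with the distance from the
  origin.\<close>

lemma admissible_density_antimono:
  assumes "admissible_density \<psi>" "\<bar>x\<bar> \<le> \<bar>y\<bar>"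
  shows "\<psi> y \<le> \<psi> x"
proof -
  have sym: "\<psi> (- s) = \<psi> s" for s
    using assms(1) unfolding admissible_density_def by metis
  have *: "\<psi> z = \<psi> \<bar>z\<bar>" for z
    using sym[of z] by (cases "z \<ge> 0") auto
  have "antimono_on {0..} \<psi>"
    using assms(1) unfolding admissible_density_def by blast
  then have "\<psi> \<bar>y\<bar> \<le> \<psi> \<bar>x\<bar>"
    using assms(2) by (auto simp: monotone_on_def)
  then show ?thesis
    by (simp only: *[of x] *[of y])
qed

lemma admissible_density_pos: "admissible_density \<psi> \<Longrightarrow> 0 < \<psi> s"
  unfolding admissible_density_def by blast

lemma admissible_density_even: "admissible_density \<psi> \<Longrightarrow> \<psi> (- s) = \<psi> s"
  unfolding admissible_density_def by metis

lemma admissible_density_integrable: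
  assumes "admissible_density \<psi>"
  shows "integrable lborel \<psi>" "(LINT s|lborel. \<psi> s) = 1"
    "integrable lborel (\<lambda>s. \<psi> (s - t))" "(LINT s|lborel. \<psi> (s - t)) = 1"
proof -
  show 1: "integrable lborel \<psi>" and 2: "(LINT s|lborel. \<psi> s) = 1"
    using assms unfolding admissible_density_def has_bochner_integral_iff by blast+
  show "integrable lborel (\<lambda>s. \<psi> (s - t))"
    using lborel_integrable_real_affine[OF 1, of 1 "-t"] by simp
  show "(LINT s|lborel. \<psi> (s - t)) = 1"
    using lborel_integral_real_affine[of 1 \<psi> "-t"] 2 by simp
qed

text \<open>Viewing \<open>dist_fun\<close> as the \<open>cdf\<close> of a probability law supplies
  its bounds and its limits at both infinities.\<close>

lemma admissible_density_distribution:
  assumes "admissible_density \<psi>"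
  shows "real_distribution (density lborel \<psi>)" "cdf (density lborel \<psi>) = dist_fun \<psi>"
proof -
  note int = admissible_density_integrable[OF assms]
  have pos: "\<psi> s \<ge> 0" for s
    using admissible_density_pos[OF assms, of s] by simp
  have [measurable]: "\<psi> \<in> borel_measurable borel"
    using borel_measurable_integrable[OF int(1)] by simp
  have "prob_space (density lborel \<psi>)"
    by standard (simp add: emeasure_density nn_integral_eq_integral pos int(1,2))
  then interpret real_distribution "density lborel \<psi>"
    by (auto simp: real_distribution_def real_distribution_axioms_def)
  show "real_distribution (density lborel \<psi>)"
    by unfold_locales
  show "cdf (density lborel \<psi>) = dist_fun \<psi>"
  proof
    fix x
    have "cdf (density lborel \<psi>) x = integral\<^sup>L (density lborel \<psi>) (indicator {..x})"
      by (simp add: cdf_def)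
    also have "\<dots> = (LINT s|lborel. \<psi> s * indicator {..x} s)"
      by (subst integral_real_density) (auto simp: pos)
    also have "\<dots> = dist_fun \<psi> x"
      by (simp add: dist_fun_def set_lebesgue_integral_def mult.commute)
    finally show "cdf (density lborel \<psi>) x = dist_fun \<psi> x" .
  qed
qed

text \<open>Near \<open>x\<close> the improper integral splits into the constant
  \<open>dist_fun \<psi> (x - 1)\<close> and an integral over a compact interval, to which the
  fundamental theorem of calculus applies because \<open>\<psi>\<close> is continuous.\<close>

lemma dist_fun_has_derivative:
  assumes "admissible_density \<psi>"
  shows "(dist_fun \<psi> has_real_derivative \<psi> x) (at x)"
proof -
  note int = admissible_density_integrable[OF assms]
  have cont: "continuous_on A \<psi>" for A
    using assms continuous_on_subset unfolding admissible_density_def by blast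
  have si: "set_integrable lborel A \<psi>" if "A \<in> sets borel" for A
    unfolding set_integrable_def using integrable_mult_indicator[OF _ int(1), of A] that by simp
  have eq: "dist_fun \<psi> y = dist_fun \<psi> (x - 1) + integral {x-1..y} \<psi>" if "y \<in> {x-1<..<x+1}" for y
  proof -
    have "{..y} = {..x-1} \<union> {x-1<..y}"
      using that by auto
    then have "dist_fun \<psi> y = dist_fun \<psi> (x - 1) + (LINT s:{x-1<..y}|lborel. \<psi> s)"
      unfolding dist_fun_def by (auto intro!: set_integral_Un si)
    also have "(LINT s:{x-1<..y}|lborel. \<psi> s) = integral {x-1<..y} \<psi>"
      by (intro set_borel_integral_eq_integral si) auto
    also have "\<dots> = integral {x-1..y} \<psi>"
    proof (rule integral_subset_negligible)
      have "{x-1..y} - {x-1<..y} = {x-1}"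
        using that by auto
      then show "negligible ({x-1..y} - {x-1<..y})"
        by simp
    qed auto
    finally show ?thesis .
  qed
  have "((\<lambda>y. integral {x-1..y} \<psi>) has_real_derivative \<psi> x) (at x within {x-1..x+1})"
    by (rule integral_has_real_derivative[OF cont]) simp
  then have "((\<lambda>y. integral {x-1..y} \<psi>) has_real_derivative \<psi> x) (at x)"
    using at_within_Icc_at[of "x - 1" x "x + 1"] by simp
  then have "((\<lambda>y. dist_fun \<psi> (x - 1) + integral {x-1..y} \<psi>) has_real_derivative \<psi> x) (at x)"
    using DERIV_add[OF DERIV_const] by fastforce
  then show ?thesis
    by (rule has_field_derivative_transform_within_open[of _ _ _ "{x-1<..<x+1}"])
       (auto simp: eq)
qed

lemma dist_fun_strict_mono:
  assumes "admissible_density \<psi>"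
  shows "strict_mono (dist_fun \<psi>)"
proof (rule strict_monoI)
  fix x y :: real assume "x < y"
  then show "dist_fun \<psi> x < dist_fun \<psi> y"
    by (rule DERIV_pos_imp_increasing)
       (use assms in \<open>blast intro: dist_fun_has_derivative admissible_density_pos\<close>)
qed

lemma dist_fun_bounds:
  assumes "admissible_density \<psi>"
  shows "0 < dist_fun \<psi> x" "dist_fun \<psi> x < 1"
proof -
  interpret D: real_distribution "density lborel \<psi>"
    by (rule admissible_density_distribution[OF assms])
  note cdf = admissible_density_distribution(2)[OF assms, symmetric]
  have "dist_fun \<psi> (x - 1) < dist_fun \<psi> x" "dist_fun \<psi> x < dist_fun \<psi> (x + 1)"
    using dist_fun_strict_mono[OF assms] by (auto simp: strict_mono_def)
  moreover have "0 \<le> dist_fun \<psi> (x - 1)" "dist_fun \<psi> (x + 1) \<le> 1"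
    unfolding cdf by (auto intro: D.cdf_nonneg D.cdf_bounded_prob)
  ultimately show "0 < dist_fun \<psi> x" "dist_fun \<psi> x < 1"
    by linarith+
qed

text \<open>Reflect the variable of integration and use evenness; the endpoint \<open>x\<close> is a
  null set, so the closed tail may be replaced by the open one.\<close>

lemma dist_fun_minus:
  assumes "admissible_density \<psi>"
  shows "dist_fun \<psi> (- x) = (LINT s:{x<..}|lborel. \<psi> s)"
proof -
  have "dist_fun \<psi> (- x) = (LINT s|lborel. indicator {..-x} (- s) * \<psi> (- s))"
    using lborel_integral_real_affine[of "-1" "\<lambda>s. indicator {..-x} s * \<psi> s" 0]
    by (simp add: dist_fun_def set_lebesgue_integral_def)
  also have "\<dots> = (LINT s|lborel. indicator {x..} s * \<psi> s)"
    by (intro Bochner_Integration.integral_cong)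
      (auto simp: admissible_density_even[OF assms] indicator_def)
  also have "\<dots> = (LINT s|lborel. indicator {x<..} s * \<psi> s)"
  proof (rule integral_cong_AE)
    show "AE s in lborel. indicator {x..} s * \<psi> s = indicator {x<..} s * \<psi> s"
      using AE_lborel_singleton[of x] by eventually_elim (auto simp: indicator_def)
  qed (use borel_measurable_integrable[OF admissible_density_integrable(1)[OF assms]] in auto)
  finally show ?thesis
    by (simp add: set_lebesgue_integral_def)
qed

text \<open>The roles of the two densities change at \<open>\<beta>/2\<close>: to the left
  \<open>s - \<beta>\<close> is at least as far from the origin as \<open>s\<close>, to the right it
  is nearer. After a shift on the left and a reflection on the right, each half contributes the same
  tail.\<close>

lemma integral_min_admissible_density:
  assumes "admissible_density \<psi>" "\<beta> > 0"
  shows "(LINT s|lborel. min (\<psi> s) (\<psi> (s - \<beta>))) = 2 * dist_fun \<psi> (- \<beta> / 2)"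
proof -
  note int = admissible_density_integrable[OF assms(1)]
  have si: "integrable lborel (\<lambda>s. indicator A s * f s)"
    if "A \<in> sets borel" "integrable lborel f" for A and f :: "real \<Rightarrow> real"
    using integrable_mult_indicator[OF _ that(2), of A] that by simp
  have split: "min (\<psi> s) (\<psi> (s - \<beta>)) =
      indicator {..\<beta>/2} s * \<psi> (s - \<beta>) + indicator {\<beta>/2<..} s * \<psi> s" for s
    using admissible_density_antimono[OF assms(1), of s "s - \<beta>"]
      admissible_density_antimono[OF assms(1), of "s - \<beta>" s] assms(2)
    by (auto simp: indicator_def min_def abs_if split: if_splits)
  have "(LINT s|lborel. min (\<psi> s) (\<psi> (s - \<beta>))) =
      (LINT s|lborel. indicator {..\<beta>/2} s * \<psi> (s - \<beta>)) + (LINT s|lborel. indicator {\<beta>/2<..} s * \<psi> s)"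
    unfolding split by (intro Bochner_Integration.integral_add si int) auto
  also have "(LINT s|lborel. indicator {\<beta>/2<..} s * \<psi> s) = dist_fun \<psi> (- \<beta> / 2)"
    using dist_fun_minus[OF assms(1), of "\<beta>/2"] by (simp add: set_lebesgue_integral_def)
  also have "(LINT s|lborel. indicator {..\<beta>/2} s * \<psi> (s - \<beta>)) =
      (LINT s|lborel. indicator {..\<beta>/2} (\<beta> + s) * \<psi> s)"
    using lborel_integral_real_affine[of 1 "\<lambda>s. indicator {..\<beta>/2} s * \<psi> (s - \<beta>)" \<beta>] by simp
  also have "\<dots> = dist_fun \<psi> (- \<beta> / 2)"
    unfolding dist_fun_def set_lebesgue_integral_def
    by (intro Bochner_Integration.integral_cong) (auto simp: indicator_def)
  finally show ?thesis
    by simp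
qed

text \<open>\<open>dist_fun \<psi>\<close> is continuous and strictly increasing with limits 0 and
  1, so it attains \<open>q\<close> at a single point \<open>x\<close>, and the infimum is taken
  over the half-line \<open>{x..}\<close>. The equivalence turns events about the quantile into
  events about \<open>q\<close>.\<close>

lemma le_quantile_fun_iff:
  assumes "admissible_density \<psi>" "q \<in> {0<..<1}"
  shows "y \<le> quantile_fun \<psi> q \<longleftrightarrow> dist_fun \<psi> y \<le> q"
proof -
  interpret D: real_distribution "density lborel \<psi>"
    by (rule admissible_density_distribution[OF assms(1)])
  note cdf = admissible_density_distribution(2)[OF assms(1)]
  let ?S = "{t. dist_fun \<psi> t \<ge> q}"
  have sm: "strict_mono (dist_fun \<psi>)"
    by (rule dist_fun_strict_mono[OF assms(1)])
  have "eventually (\<lambda>t. q < dist_fun \<psi> t) at_top"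
    using order_tendstoD(1)[OF D.cdf_lim_at_top_prob, of q] assms(2) by (simp add: cdf)
  then obtain u where u: "q < dist_fun \<psi> u"
    by (auto simp: eventually_at_top_linorder)
  have "eventually (\<lambda>t. dist_fun \<psi> t < q) at_bot"
    using order_tendstoD(2)[OF D.cdf_lim_at_bot, of q] assms(2) by (simp add: cdf)
  then obtain l where l: "dist_fun \<psi> l < q"
    by (auto simp: eventually_at_bot_linorder)
  obtain x where x: "dist_fun \<psi> x = q"
  proof (rule that[of "SOME x. dist_fun \<psi> x = q"], rule someI_ex)
    have "l \<le> u"
      using l u strict_mono_less[OF sm, of l u] by auto
    then show "\<exists>x. dist_fun \<psi> x = q"
      using IVT[of "dist_fun \<psi>" l q u] l u DERIV_isCont[OF dist_fun_has_derivative[OF assms(1)]]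
      by auto
  qed
  then have "?S = {x..}"
    using strict_mono_less_eq[OF sm] by auto
  then have "quantile_fun \<psi> q = x"
    by (simp add: quantile_fun_def)
  then show ?thesis
    using strict_mono_less_eq[OF sm, of y x] x by simp
qed

subsection \<open>Exceedance probabilities of generalized Pareto processes\<close>

lemma closure_Rats_unit_interval: "closure (\<rat> \<inter> {0..1}) = {0..1::real}"
proof (rule antisym)
  show "closure (\<rat> \<inter> {0..1}) \<subseteq> {0..1::real}"
    by (rule closure_minimal) auto
  have "x \<in> closure \<rat>" for x :: real
    unfolding closure_approachable
  proof (intro allI impI)
    fix e :: real assume "e > 0"
    then obtain r where "r \<in> \<rat>" "x < r" "r < x + e"
      using Rats_dense_in_real[of x "x + e"] by auto
    then show "\<exists>y\<in>\<rat>. dist y x < e"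
      by (intro bexI[of _ r]) (auto simp: dist_real_def)
  qed
  then have "closure ({0<..<1} \<inter> \<rat>) = closure {0<..<1::real}"
    by (intro closure_open_Int_superset) auto
  then show "{0..1::real} \<subseteq> closure (\<rat> \<inter> {0..1})"
    using closure_mono[of "{0<..<1} \<inter> \<rat>" "\<rat> \<inter> {0..1::real}"] by fastforce
qed

text \<open>A condition at all times in \<open>{0..1}\<close> involves uncountably many coordinates.
  Rational times make the set measurable in the product space, and the margin
  \<open>inverse (real (Suc k))\<close> preserves strictness when passing to limits. The set
  expresses exceedance of \<open>c\<close> for continuous paths only.\<close>

definition paths_above :: "real \<Rightarrow> (real \<Rightarrow> real) set" where
  "paths_above c =
    {p \<in> space path_space. \<exists>k. \<forall>t\<in>\<rat> \<inter> {0..1}. c + inverse (real (Suc k)) < p t}"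

text \<open>A continuous path attains its minimum on the compact interval, which yields a uniform
  margin above \<open>c\<close>. Conversely, a weak bound with margin extends from the rationals to
  their closure and is still strict at level \<open>c\<close>.\<close>

lemma gt_on_unit_interval_iff:
  fixes f :: "real \<Rightarrow> real"
  assumes f: "continuous_on {0..1} f"
  shows "(\<forall>t\<in>{0..1}. c < f t) \<longleftrightarrow>
    (\<exists>k. \<forall>t\<in>\<rat> \<inter> {0..1}. c + inverse (real (Suc k)) < f t)"
proof
  assume *: "\<forall>t\<in>{0..1}. c < f t"
  obtain m where m: "m \<in> {0..1}" "\<forall>t\<in>{0..1}. f m \<le> f t"
    using continuous_attains_inf[OF _ _ f] by auto
  then have "0 < f m - c"
    using * by auto
  then obtain k where k: "inverse (real (Suc k)) < f m - c"
    using reals_Archimedean by blast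
  show "\<exists>k. \<forall>t\<in>\<rat> \<inter> {0..1}. c + inverse (real (Suc k)) < f t"
  proof (intro exI ballI)
    fix t :: real assume "t \<in> \<rat> \<inter> {0..1}"
    then have "f m \<le> f t"
      using m(2) by blast
    then show "c + inverse (real (Suc k)) < f t"
      using k by linarith
  qed
next
  assume "\<exists>k. \<forall>t\<in>\<rat> \<inter> {0..1}. c + inverse (real (Suc k)) < f t"
  then obtain k where k: "\<And>t. t \<in> \<rat> \<inter> {0..1} \<Longrightarrow> c + inverse (real (Suc k)) < f t"
    by blast
  show "\<forall>t\<in>{0..1}. c < f t"
  proof
    fix t :: real assume "t \<in> {0..1}"
    then have t: "t \<in> closure (\<rat> \<inter> {0..1})"
      by (simp only: closure_Rats_unit_interval)
    have "continuous_on (closure (\<rat> \<inter> {0..1})) f"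
      unfolding closure_Rats_unit_interval by (rule f)
    then have "c + inverse (real (Suc k)) \<le> f t"
      using t by (rule continuous_ge_on_closure) (rule less_imp_le[OF k])
    moreover have "0 < inverse (real (Suc k))"
      by simp
    ultimately show "c < f t"
      by linarith
  qed
qed

lemma sets_paths_above [measurable]: "paths_above c \<in> sets path_space"
proof -
  have "countable (\<rat> \<inter> {0..1::real})"
    by (simp add: countable_rat)
  moreover have [measurable]: "(\<lambda>p. p t) \<in> borel_measurable path_space" if "t \<in> \<rat> \<inter> {0..1}" for t
    using that by (intro measurable_component_singleton) auto
  ultimately show ?thesis
    unfolding paths_above_def by measurable
qed

lemma path_in_paths_above_iff:
  assumes "process_with_paths_in C01 M X" "\<omega> \<in> space M"
  shows "path X \<omega> \<in> paths_above c \<longleftrightarrow> (\<forall>t\<in>{0..1}. c < X t \<omega>)"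
proof -
  have "path X \<omega> \<in> space path_space"
    by (auto simp: path_def space_PiM)
  moreover have "continuous_on {0..1} (\<lambda>t. X t \<omega>)"
    using assms by (auto simp: process_with_paths_in_def C01_def)
  moreover have "path X \<omega> t = X t \<omega>" if "t \<in> \<rat> \<inter> {0..1}" for t
    using that by (auto simp: path_def)
  ultimately show ?thesis
    using gt_on_unit_interval_iff[of "\<lambda>t. X t \<omega>" c] by (simp add: paths_above_def)
qed

lemma path_measurable:
  assumes "process_with_paths_in S M X"
  shows "path X \<in> measurable M path_space"
  unfolding path_def[abs_def]
  by (rule measurable_restrict) (use assms in \<open>simp add: process_with_paths_in_def\<close>)

lemma path_above_event:
  assumes "process_with_paths_in C01 M X"
  shows "{\<omega> \<in> space M. \<forall>t\<in>{0..1}. c < X t \<omega>} = path X -` paths_above c \<inter> space M"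
    and "{\<omega> \<in> space M. \<forall>t\<in>{0..1}. c < X t \<omega>} \<in> sets M"
proof -
  show eq: "{\<omega> \<in> space M. \<forall>t\<in>{0..1}. c < X t \<omega>} = path X -` paths_above c \<inter> space M"
    using path_in_paths_above_iff[OF assms] by auto
  show "{\<omega> \<in> space M. \<forall>t\<in>{0..1}. c < X t \<omega>} \<in> sets M"
    unfolding eq by (intro measurable_sets[OF path_measurable[OF assms]] sets_paths_above)
qed

text \<open>The exceedance probability depends on the law of the path alone, so it is shared by all
  copies of the process.\<close>

lemma prob_gt_const_eq_distr:
  assumes "process_with_paths_in C01 M X"
  shows "prob_gt M X (\<lambda>_. c) = measure (distr M path_space (path X)) (paths_above c)"
  using path_above_event[OF assms, of c] path_measurable[OF assms]
  by (simp add: prob_gt_def measure_distr)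

lemma process_with_paths_in_mono:
  "process_with_paths_in S M X \<Longrightarrow> S \<subseteq> T \<Longrightarrow> process_with_paths_in T M X"
  by (auto simp: process_with_paths_in_def)

lemma const_in_Ebar_minus: "x \<le> 0 \<Longrightarrow> (\<lambda>_. x) \<in> Ebar_minus"
  by (auto simp: Ebar_minus_def bounded_iff)

lemma sup_norm01_const: "sup_norm01 (\<lambda>_. x) = \<bar>x\<bar>"
  by (simp add: sup_norm01_def)

text \<open>These test functions constrain the process at the finitely many times in
  \<open>T\<close> and elsewhere demand only nonpositivity; they give access to finite dimensional
  distributions. Off the closed set \<open>T\<close> they are locally constant.\<close>

lemma spike_in_Ebar_minus:
  assumes "finite T" "x \<le> 0"
  shows "(\<lambda>t. if t \<in> T then x else 0) \<in> Ebar_minus"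
proof -
  have "continuous (at t within {0..1}) (\<lambda>t. if t \<in> T then x else 0)" if "t \<notin> T" for t
  proof -
    have "continuous_on (- T) (\<lambda>t. if t \<in> T then x else 0)"
      by (rule continuous_on_eq[OF continuous_on_const[of _ 0]]) auto
    moreover have "open (- T)"
      using assms(1) by (auto intro: finite_imp_closed)
    ultimately show ?thesis
      using that by (auto simp: continuous_on_eq_continuous_at intro: continuous_at_imp_continuous_at_within)
  qed
  then have "{t \<in> {0..1}. \<not> continuous (at t within {0..1}) (\<lambda>t. if t \<in> T then x else 0)} \<subseteq> T"
    by blast
  then have "finite {t \<in> {0..1}. \<not> continuous (at t within {0..1}) (\<lambda>t. if t \<in> T then x else 0)}"
    using assms(1) by (rule finite_subset)
  moreover have "bounded ((\<lambda>t. if t \<in> T then x else 0) ` {0..1})"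
    by (rule bounded_subset[of "{x, 0}"]) auto
  ultimately show ?thesis
    using assms(2) by (auto simp: Ebar_minus_def)
qed

lemma sup_norm01_spike: "sup_norm01 (\<lambda>t. if t \<in> T then x else 0) \<le> \<bar>x\<bar>"
  unfolding sup_norm01_def by (rule cSUP_least) auto

text \<open>The bound existentially quantified in \<open>standard_GPP\<close> becomes the parameter
  \<open>x0\<close>, and the law of \<open>V\<close> enters through the integral formula.\<close>

locale gpp_process = prob_space N for N :: "'v measure" +
  fixes \<beta> :: real and \<psi> :: "real \<Rightarrow> real" and V :: "real \<Rightarrow> 'v \<Rightarrow> real" and x0 :: real
  assumes psi: "admissible_density \<psi>"
    and beta_pos: "\<beta> > 0" and x0_pos: "x0 > 0"
    and V_process: "process_with_paths_in C01 N V"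
    and prob_le_eq: "\<And>f. f \<in> Ebar_minus \<Longrightarrow> sup_norm01 f \<le> x0 \<Longrightarrow>
      prob_le N V f = 1 - (LINT s|lborel. (SUP t\<in>{0..1}. \<bar>f t\<bar> * \<psi> (s - \<beta> * t)))"
begin

lemma measurable_V [measurable]: "t \<in> {0..1} \<Longrightarrow> V t \<in> borel_measurable N"
  using V_process by (auto simp: process_with_paths_in_def)

lemma nonpos_event:
  shows "{\<omega> \<in> space N. \<forall>t\<in>{0..1}. V t \<omega> \<le> 0} \<in> events" (is "?A \<in> _")
    and "AE \<omega> in N. \<forall>t\<in>{0..1}. V t \<omega> \<le> 0"
proof -
  have 1: "prob ?A = 1"
    using prob_le_eq[OF const_in_Ebar_minus[of 0]] x0_pos
    by (simp add: sup_norm01_const prob_le_def)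
  \<comment> \<open>A non-measurable set has \<open>measure\<close> 0 by convention, so the value 1,
    obtained from the test function 0, forces measurability.\<close>
  show 2: "?A \<in> events"
    using measure_notin_sets[of ?A N] 1 by fastforce
  show "AE \<omega> in N. \<forall>t\<in>{0..1}. V t \<omega> \<le> 0"
    using 1 prob_Collect_eq_1[OF 2] by simp
qed

text \<open>Apply the integral formula to the function equal to \<open>x\<close> on \<open>T\<close>
  and 0 elsewhere. Since the process is almost surely nonpositive, the event reduces to the
  constraints at times in \<open>T\<close>; then take complements.\<close>

lemma prob_exists_gt:
  assumes T: "finite T" "T \<noteq> {}" "T \<subseteq> {0..1}" and x: "x \<le> 0" "\<bar>x\<bar> \<le> x0"
  shows "prob {\<omega> \<in> space N. \<exists>t\<in>T. x < V t \<omega>} =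
    \<bar>x\<bar> * (LINT s|lborel. Max ((\<lambda>t. \<psi> (s - \<beta> * t)) ` T))"
proof -
  define f where "f = (\<lambda>t. if t \<in> T then x else 0)"
  have [measurable]: "V t \<in> borel_measurable N" if "t \<in> T" for t
    using that T(3) by auto
  have cT: "countable T"
    using T(1) by (rule countable_finite)
  \<comment> \<open>Times outside \<open>T\<close> contribute 0, and the density is positive, so the
    supremum is a maximum attained on \<open>T\<close>.\<close>
  have SUP: "(SUP t\<in>{0..1}. \<bar>f t\<bar> * \<psi> (s - \<beta> * t)) = \<bar>x\<bar> * Max ((\<lambda>t. \<psi> (s - \<beta> * t)) ` T)" for s
  proof (rule cSup_eq_maximum)
    have "Max ((\<lambda>t. \<psi> (s - \<beta> * t)) ` T) \<in> (\<lambda>t. \<psi> (s - \<beta> * t)) ` T"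
      using T by (intro Max_in) auto
    then obtain t where "t \<in> T" "Max ((\<lambda>t. \<psi> (s - \<beta> * t)) ` T) = \<psi> (s - \<beta> * t)"
      by blast
    then show "\<bar>x\<bar> * Max ((\<lambda>t. \<psi> (s - \<beta> * t)) ` T) \<in> (\<lambda>t. \<bar>f t\<bar> * \<psi> (s - \<beta> * t)) ` {0..1}"
      using T(3) by (intro image_eqI[of _ _ t]) (auto simp: f_def)
    have Max: "\<psi> (s - \<beta> * t) \<le> Max ((\<lambda>t. \<psi> (s - \<beta> * t)) ` T)" if "t \<in> T" for t
      using T(1) that by (intro Max_ge) auto
    obtain t0 where "t0 \<in> T"
      using T(2) by blast
    then have nn: "0 \<le> Max ((\<lambda>t. \<psi> (s - \<beta> * t)) ` T)"
      using Max[of t0] admissible_density_pos[OF psi, of "s - \<beta> * t0"] by linarith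
    fix y assume "y \<in> (\<lambda>t. \<bar>f t\<bar> * \<psi> (s - \<beta> * t)) ` {0..1}"
    then show "y \<le> \<bar>x\<bar> * Max ((\<lambda>t. \<psi> (s - \<beta> * t)) ` T)"
      using Max nn by (auto simp: f_def intro!: mult_left_mono)
  qed
  let ?B = "{\<omega> \<in> space N. \<forall>t\<in>T. V t \<omega> \<le> x}"
  have [measurable]: "?B \<in> events"
    using cT by measurable
  let ?A = "{\<omega> \<in> space N. \<forall>t\<in>{0..1}. V t \<omega> \<le> 0}"
  have "{\<omega> \<in> space N. \<forall>t\<in>{0..1}. V t \<omega> \<le> f t} = ?A \<inter> ?B"
  proof (intro set_eqI)
    fix \<omega>
    have "(\<forall>t\<in>{0..1}. V t \<omega> \<le> f t) \<longleftrightarrow> (\<forall>t\<in>{0..1}. V t \<omega> \<le> 0) \<and> (\<forall>t\<in>T. V t \<omega> \<le> x)"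
    proof (intro iffI conjI ballI)
      fix t :: real assume "\<forall>t\<in>{0..1}. V t \<omega> \<le> f t" "t \<in> {0..1}"
      moreover have "f t \<le> 0"
        using x(1) by (simp add: f_def)
      ultimately show "V t \<omega> \<le> 0"
        by fastforce
    next
      fix t assume *: "\<forall>t\<in>{0..1}. V t \<omega> \<le> f t" and t: "t \<in> T"
      then have "V t \<omega> \<le> f t"
        using T(3) by blast
      then show "V t \<omega> \<le> x"
        using t by (simp add: f_def)
    qed (simp add: f_def)
    then show "\<omega> \<in> {\<omega> \<in> space N. \<forall>t\<in>{0..1}. V t \<omega> \<le> f t} \<longleftrightarrow> \<omega> \<in> ?A \<inter> ?B"
      by blast
  qed
  then have "prob_le N V f = prob (?A \<inter> ?B)"
    by (simp add: prob_le_def)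
  also have "\<dots> = prob ?B"
    by (rule finite_measure_eq_AE) (use nonpos_event in auto)
  finally have "prob ?B = prob_le N V f" ..
  then have "prob ?B = 1 - \<bar>x\<bar> * (LINT s|lborel. Max ((\<lambda>t. \<psi> (s - \<beta> * t)) ` T))"
    using prob_le_eq[of f] spike_in_Ebar_minus[OF T(1) x(1)] sup_norm01_spike[of T x] x(2)
    by (simp add: f_def[symmetric] SUP)
  moreover have "{\<omega> \<in> space N. \<exists>t\<in>T. x < V t \<omega>} = space N - ?B"
    by (auto simp: not_le)
  ultimately show ?thesis
    by (simp add: prob_compl)
qed

context
  fixes x :: real
  assumes x: "x \<le> 0" "\<bar>x\<bar> \<le> x0"
begin

private abbreviation U :: "real \<Rightarrow> 'v set" where
  "U t \<equiv> {\<omega> \<in> space N. x < V t \<omega>}"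

private lemma U_event [measurable]: "t \<in> {0..1} \<Longrightarrow> U t \<in> events"
  by measurable

private lemma integrable_shift: "integrable lborel (\<lambda>s. \<psi> (s - t))"
  by (rule admissible_density_integrable[OF psi])

private lemma prob_U: "t \<in> {0..1} \<Longrightarrow> prob (U t) = \<bar>x\<bar>"
  using prob_exists_gt[of "{t}", OF _ _ _ x] admissible_density_integrable(4)[OF psi] by simp

private lemma prob_U_Un:
  assumes "t \<in> {0..1}" "u \<in> {0..1}"
  shows "prob (U t \<union> U u) = \<bar>x\<bar> * (LINT s|lborel. max (\<psi> (s - \<beta> * t)) (\<psi> (s - \<beta> * u)))"
proof -
  have "U t \<union> U u = {\<omega> \<in> space N. \<exists>t\<in>{t, u}. x < V t \<omega>}"
    by auto
  then show ?thesis
    using prob_exists_gt[of "{t, u}", OF _ _ _ x] assms by simp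
qed

text \<open>Inclusion-exclusion: each marginal has probability \<open>\<bar>x\<bar>\<close>, the
  union gives the integral of the maximum, and \<open>max a b = a + b - min a b\<close> leaves the
  integral of the minimum.\<close>

lemma prob_endpoints_gt:
  "prob {\<omega> \<in> space N. x < V 0 \<omega> \<and> x < V 1 \<omega>} = \<bar>x\<bar> * (2 * dist_fun \<psi> (- \<beta> / 2))"
proof -
  have [measurable]: "V 0 \<in> borel_measurable N" "V 1 \<in> borel_measurable N"
    by auto
  have max: "max a b = a + b - min a b" for a b :: real
    by (simp add: max_def min_def)
  have "prob (U 0 \<union> U 1) = \<bar>x\<bar> * (LINT s|lborel. max (\<psi> s) (\<psi> (s - \<beta>)))"
    using prob_U_Un[of 0 1] by simp
  also have "(LINT s|lborel. max (\<psi> s) (\<psi> (s - \<beta>))) =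
      (LINT s|lborel. \<psi> s + \<psi> (s - \<beta>)) - (LINT s|lborel. min (\<psi> s) (\<psi> (s - \<beta>)))"
    unfolding max using integrable_shift[of 0] integrable_shift[of \<beta>]
    by (intro Bochner_Integration.integral_diff) auto
  also have "(LINT s|lborel. \<psi> s + \<psi> (s - \<beta>)) = 2"
    using integrable_shift[of 0] integrable_shift[of \<beta>] admissible_density_integrable[OF psi]
    by (subst Bochner_Integration.integral_add) auto
  finally have "prob (U 0 \<union> U 1) = \<bar>x\<bar> * (2 - 2 * dist_fun \<psi> (- \<beta> / 2))"
    by (simp only: integral_min_admissible_density[OF psi beta_pos])
  moreover have "prob (U 0 \<union> U 1) = prob (U 0) + prob (U 1) - prob (U 0 \<inter> U 1)"
    by (rule measure_Un3) (auto simp: fmeasurable_eq_sets)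
  moreover have "U 0 \<inter> U 1 = {\<omega> \<in> space N. x < V 0 \<omega> \<and> x < V 1 \<omega>}"
    by auto
  ultimately show ?thesis
    by (simp add: prob_U algebra_simps)
qed

text \<open>By unimodality \<open>min (\<psi> s) (\<psi> (s - \<beta>)) \<le> \<psi> (s - \<beta> * t)\<close>, so the two endpoints
  already decide whether the path exceeds \<open>x\<close>.\<close>

lemma AE_endpoints_gt_imp_gt:
  assumes t: "t \<in> {0..1}"
  shows "AE \<omega> in N. x < V 0 \<omega> \<and> x < V 1 \<omega> \<longrightarrow> x < V t \<omega>"
proof -
  have [measurable]: "V 0 \<in> borel_measurable N" "V 1 \<in> borel_measurable N" "V t \<in> borel_measurable N"
    using t by auto
  let ?m = "\<lambda>a b s. max (\<psi> (s - \<beta> * a)) (\<psi> (s - \<beta> * b))"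
  let ?m3 = "\<lambda>s. max (\<psi> s) (max (\<psi> (s - \<beta>)) (\<psi> (s - \<beta> * t)))"
  have int: "integrable lborel (?m a b)" for a b
    using integrable_shift by (intro integrable_max) auto
  have int3: "integrable lborel ?m3"
    using int[of 1 t] integrable_shift[of 0] by (intro integrable_max[OF _ int[of 1 t, simplified]]) auto
  have "U 0 \<union> (U 1 \<union> U t) = {\<omega> \<in> space N. \<exists>u\<in>{0, 1, t}. x < V u \<omega>}"
    by auto
  then have U3: "prob (U 0 \<union> (U 1 \<union> U t)) = \<bar>x\<bar> * (LINT s|lborel. ?m3 s)"
    using prob_exists_gt[of "{0, 1, t}", OF _ _ _ x] t by simp
  \<comment> \<open>The left side is the maximum of \<open>\<psi> (s - \<beta> * t)\<close> and the
    smaller of the two endpoint densities. As \<open>\<beta> * t\<close> lies between 0 and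
    \<open>\<beta>\<close>, the shifted argument is no farther from the origin than one of the
    endpoint arguments.\<close>
  have point: "?m 0 t s + ?m 1 t s - ?m3 s = \<psi> (s - \<beta> * t)" for s
  proof -
    have "0 \<le> \<beta> * t" "\<beta> * t \<le> \<beta>"
      using t beta_pos mult_left_mono[of t 1 \<beta>] by auto
    then have "\<bar>s - \<beta> * t\<bar> \<le> \<bar>s\<bar> \<or> \<bar>s - \<beta> * t\<bar> \<le> \<bar>s - \<beta>\<bar>"
      by linarith
    then have "\<psi> s \<le> \<psi> (s - \<beta> * t) \<or> \<psi> (s - \<beta>) \<le> \<psi> (s - \<beta> * t)"
      using admissible_density_antimono[OF psi] by blast
    then show ?thesis
      by (auto simp: max_def)
  qed
  \<comment> \<open>Rewriting by distributivity expresses the probability through unions, the only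
    events for which the integral formula is available.\<close>
  have eq: "(U 0 \<inter> U 1) \<union> U t = (U 0 \<union> U t) \<inter> (U 1 \<union> U t)"
    "(U 0 \<union> U t) \<union> (U 1 \<union> U t) = U 0 \<union> (U 1 \<union> U t)"
    by auto
  have "prob ((U 0 \<union> U t) \<union> (U 1 \<union> U t)) =
      prob (U 0 \<union> U t) + prob (U 1 \<union> U t) - prob ((U 0 \<union> U t) \<inter> (U 1 \<union> U t))"
    by (rule measure_Un3) (auto simp: fmeasurable_eq_sets)
  then have "prob ((U 0 \<inter> U 1) \<union> U t) =
      \<bar>x\<bar> * ((LINT s|lborel. ?m 0 t s) + (LINT s|lborel. ?m 1 t s) - (LINT s|lborel. ?m3 s))"
    using t unfolding eq U3 by (simp add: prob_U_Un algebra_simps)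
  also have "(LINT s|lborel. ?m 0 t s) + (LINT s|lborel. ?m 1 t s) - (LINT s|lborel. ?m3 s) =
      (LINT s|lborel. ?m 0 t s + ?m 1 t s - ?m3 s)"
    by (simp only: Bochner_Integration.integral_add Bochner_Integration.integral_diff
        Bochner_Integration.integrable_add int int3)
  also have "\<dots> = 1"
    unfolding point by (rule admissible_density_integrable[OF psi])
  finally have "prob ((U 0 \<inter> U 1) \<union> U t) = prob (U t)"
    using t by (simp add: prob_U)
  moreover have "prob ((U 0 \<inter> U 1) \<union> U t) = prob ((U 0 \<inter> U 1) - U t) + prob (U t)"
    by (subst finite_measure_Union[symmetric]) (auto intro!: arg_cong[of _ _ prob])
  ultimately have "prob ((U 0 \<inter> U 1) - U t) = 0"
    by linarith
  moreover have "(U 0 \<inter> U 1) - U t = {\<omega> \<in> space N. \<not> (x < V 0 \<omega> \<and> x < V 1 \<omega> \<longrightarrow> x < V t \<omega>)}"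
    by auto
  ultimately have "prob {\<omega> \<in> space N. \<not> (x < V 0 \<omega> \<and> x < V 1 \<omega> \<longrightarrow> x < V t \<omega>)} = 0"
    by simp
  then show ?thesis
    by (subst AE_iff_measurable[OF _ refl]) (auto simp: emeasure_eq_measure)
qed

end

text \<open>The upper bound keeps just the two endpoints. For the lower bound, exceedance at the
  endpoints almost surely carries over to the countably many rational times, and then to all times
  by continuity.\<close>

lemma prob_gt_const:
  assumes x: "x < 0" "\<bar>x\<bar> \<le> x0"
  shows "prob_gt N V (\<lambda>_. x) = 2 * \<bar>x\<bar> * dist_fun \<psi> (- \<beta> / 2)"
proof (rule antisym)
  let ?E = "{\<omega> \<in> space N. \<forall>t\<in>{0..1}. x < V t \<omega>}"
  let ?C = "2 * dist_fun \<psi> (- \<beta> / 2)"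
  have [measurable]: "V 0 \<in> borel_measurable N" "V 1 \<in> borel_measurable N"
    by auto
  have [measurable]: "?E \<in> events"
    by (rule path_above_event[OF V_process])
  have "prob ?E \<le> prob {\<omega> \<in> space N. x < V 0 \<omega> \<and> x < V 1 \<omega>}"
    by (intro finite_measure_mono) auto
  then show "prob_gt N V (\<lambda>_. x) \<le> 2 * \<bar>x\<bar> * dist_fun \<psi> (- \<beta> / 2)"
    using prob_endpoints_gt[of x] x by (simp add: prob_gt_def)
  \<comment> \<open>Passing from rational to all times weakens \<open><\<close> to
    \<open>\<le>\<close>. Starting from a higher level \<open>y\<close> absorbs this loss, and
    letting \<open>y\<close> decrease to \<open>x\<close> recovers the sharp constant.\<close>
  have lower: "\<bar>y\<bar> * ?C \<le> prob ?E" if y: "x < y" "y < 0" for y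
  proof -
    have "AE \<omega> in N. \<forall>t\<in>\<rat> \<inter> {0..1}. y < V 0 \<omega> \<and> y < V 1 \<omega> \<longrightarrow> y < V t \<omega>"
      using x y by (subst AE_ball_countable) (auto intro!: AE_endpoints_gt_imp_gt simp: countable_rat)
    then have "AE \<omega> in N. \<omega> \<in> {\<omega> \<in> space N. y < V 0 \<omega> \<and> y < V 1 \<omega>} \<longrightarrow> \<omega> \<in> ?E"
      using AE_space
    proof eventually_elim
      case (elim \<omega>)
      show ?case
      proof (intro impI CollectI conjI ballI)
        fix t :: real assume *: "\<omega> \<in> {\<omega> \<in> space N. y < V 0 \<omega> \<and> y < V 1 \<omega>}" "t \<in> {0..1}"
        have "continuous_on {0..1} (\<lambda>t. V t \<omega>)"
          using V_process elim(2) by (auto simp: process_with_paths_in_def C01_def)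
        then have "continuous_on (closure (\<rat> \<inter> {0..1})) (\<lambda>t. V t \<omega>)"
          by (simp only: closure_Rats_unit_interval)
        then have "y \<le> V t \<omega>"
          by (rule continuous_ge_on_closure)
            (use elim(1) * in \<open>auto simp only: closure_Rats_unit_interval intro: less_imp_le\<close>)
        then show "x < V t \<omega>"
          using y by linarith
      qed (rule elim(2))
    qed
    then have "prob {\<omega> \<in> space N. y < V 0 \<omega> \<and> y < V 1 \<omega>} \<le> prob ?E"
      by (intro finite_measure_mono_AE) auto
    then show ?thesis
      using prob_endpoints_gt[of y] x y by simp
  qed
  have "((\<lambda>y. \<bar>y\<bar> * ?C) \<longlongrightarrow> \<bar>x\<bar> * ?C) (at_right x)"
    by (intro tendsto_intros)
  moreover have "eventually (\<lambda>y. \<bar>y\<bar> * ?C \<le> prob ?E) (at_right x)"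
    using eventually_at_right_real[OF x(1)] by eventually_elim (rule lower; simp)
  ultimately have "\<bar>x\<bar> * ?C \<le> prob ?E"
    by (rule tendsto_upperbound) simp
  then show "2 * \<bar>x\<bar> * dist_fun \<psi> (- \<beta> / 2) \<le> prob_gt N V (\<lambda>_. x)"
    by (simp add: prob_gt_def algebra_simps)
qed

end

subsection \<open>Central limit theorem for triangular Bernoulli arrays\<close>

text \<open>As \<open>Y\<close> takes the values 0 and 1, it equals its square, so the squared
  deviation is affine in \<open>Y\<close>.\<close>

lemma (in prob_space) bernoulli_moments:
  fixes Y :: "'a \<Rightarrow> real"
  assumes [measurable]: "random_variable borel Y"
    and Y: "\<And>\<omega>. \<omega> \<in> space M \<Longrightarrow> Y \<omega> \<in> {0, 1}" and p: "expectation Y = p"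
  shows "expectation (\<lambda>\<omega>. Y \<omega> - p) = 0" "variance (\<lambda>\<omega>. Y \<omega> - p) = p * (1 - p)" "p \<in> {0..1}"
    "integrable M Y"
proof -
  show int: "integrable M Y"
    by (rule integrable_const_bound[where B=1]) (auto dest!: Y)
  show 1: "expectation (\<lambda>\<omega>. Y \<omega> - p) = 0"
    using int p by (simp add: prob_space)
  have "variance (\<lambda>\<omega>. Y \<omega> - p) = expectation (\<lambda>\<omega>. Y \<omega> * (1 - 2 * p) + p\<^sup>2)"
    unfolding 1 using Y
    by (intro Bochner_Integration.integral_cong) (auto simp: power2_eq_square algebra_simps)
  also have "\<dots> = p * (1 - p)"
    using int p by (simp add: prob_space power2_eq_square algebra_simps)
  finally show "variance (\<lambda>\<omega>. Y \<omega> - p) = p * (1 - p)" .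
  have "expectation Y \<le> expectation (\<lambda>_. 1)"
    using int by (intro integral_mono) (auto dest!: Y)
  moreover have "0 \<le> expectation Y"
    by (intro integral_nonneg_AE AE_I2) (auto dest!: Y)
  ultimately show "p \<in> {0..1}"
    using p by (simp add: prob_space)
qed

text \<open>Since \<open>\<bar>Y \<omega> - p\<bar> \<le> 1\<close>, the third absolute moment is at
  most the variance. The Taylor error is thus proportional to the variance, which matters when
  \<open>p\<close> tends to 0.\<close>

lemma (in prob_space) char_centered_bernoulli_approx:
  fixes Y :: "'a \<Rightarrow> real"
  assumes [measurable]: "random_variable borel Y"
    and Y: "\<And>\<omega>. \<omega> \<in> space M \<Longrightarrow> Y \<omega> \<in> {0, 1}" and p: "expectation Y = p"
  shows "cmod (char (distr M borel (\<lambda>\<omega>. Y \<omega> - p)) u -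
      complex_of_real (1 - u\<^sup>2 * (p * (1 - p)) / 2)) \<le> \<bar>u\<bar> ^ 3 * (p * (1 - p)) / 6"
proof -
  note mom = bernoulli_moments[OF assms]
  have bound: "\<bar>Y \<omega> - p\<bar> \<le> 1" if "\<omega> \<in> space M" for \<omega>
    using Y[OF that] mom(3) by auto
  have sq: "integrable M (\<lambda>\<omega>. (Y \<omega> - p)\<^sup>2)"
    using bound by (intro integrable_const_bound[where B=1]) (auto simp: abs_square_le_1)
  have "cmod (char (distr M borel (\<lambda>\<omega>. Y \<omega> - p)) u -
      complex_of_real (1 - u\<^sup>2 * (p * (1 - p)) / 2)) \<le> u\<^sup>2 / 6 * expectation (\<lambda>\<omega>. min (6 * (Y \<omega> - p)\<^sup>2) (\<bar>u\<bar> * \<bar>Y \<omega> - p\<bar> ^ 3))"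
    using char_approx3'[of "\<lambda>\<omega>. Y \<omega> - p", OF _ _ sq mom(1,2) refl, of u] mom(4) by simp
  also have "\<dots> \<le> u\<^sup>2 / 6 * expectation (\<lambda>\<omega>. \<bar>u\<bar> * (Y \<omega> - p)\<^sup>2)"
  proof (intro mult_left_mono integral_mono)
    show "integrable M (\<lambda>\<omega>. min (6 * (Y \<omega> - p)\<^sup>2) (\<bar>u\<bar> * \<bar>Y \<omega> - p\<bar> ^ 3))"
    proof (rule Bochner_Integration.integrable_bound)
      show "integrable M (\<lambda>\<omega>. 6 * (Y \<omega> - p)\<^sup>2)"
        using sq by simp
      have "\<bar>min a b\<bar> \<le> \<bar>a\<bar>" if "0 \<le> a" "0 \<le> b" for a b :: real
        using that by linarith
      then show "AE \<omega> in M. norm (min (6 * (Y \<omega> - p)\<^sup>2) (\<bar>u\<bar> * \<bar>Y \<omega> - p\<bar> ^ 3)) \<le> norm (6 * (Y \<omega> - p)\<^sup>2)"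
        unfolding real_norm_def by (intro AE_I2) simp
    qed measurable
    fix \<omega> assume \<omega>: "\<omega> \<in> space M"
    have "\<bar>Y \<omega> - p\<bar> ^ 3 \<le> \<bar>Y \<omega> - p\<bar> ^ 2"
      using bound[OF \<omega>] by (intro power_decreasing) auto
    then show "min (6 * (Y \<omega> - p)\<^sup>2) (\<bar>u\<bar> * \<bar>Y \<omega> - p\<bar> ^ 3) \<le> \<bar>u\<bar> * (Y \<omega> - p)\<^sup>2"
      by (intro min.coboundedI2 mult_left_mono) auto
  qed (use sq in auto)
  also have "\<dots> = \<bar>u\<bar> ^ 3 * (p * (1 - p)) / 6"
    using mom(1,2) by (simp add: power3_eq_cube power2_eq_square[of u])
  finally show ?thesis .
qed

text \<open>The characteristic function of the normalized sum is a product, compared factor by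
  factor with \<open>(1 - t^2 / (2 n))^n\<close>. The errors add up to at most
  \<open>\<bar>t\<bar>^3 / 6\<close> divided by the standard deviation, so its divergence suffices
  even if the success probabilities vanish.\<close>

lemma (in prob_space) de_Moivre_Laplace:
  fixes Y :: "nat \<Rightarrow> nat \<Rightarrow> 'a \<Rightarrow> real" and p :: "nat \<Rightarrow> real"
  assumes indep: "\<And>n. indep_vars (\<lambda>_. borel) (Y n) {1..n}"
    and Y01: "\<And>n i \<omega>. i \<in> {1..n} \<Longrightarrow> \<omega> \<in> space M \<Longrightarrow> Y n i \<omega> \<in> {0, 1}"
    and mean: "\<And>n i. i \<in> {1..n} \<Longrightarrow> expectation (Y n i) = p n"
    and sd: "filterlim (\<lambda>n. sqrt (real n * (p n * (1 - p n)))) at_top sequentially"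
  shows "weak_conv_m
    (\<lambda>n. distr M borel (\<lambda>\<omega>. ((\<Sum>i=1..n. Y n i \<omega>) - n * p n) / sqrt (real n * (p n * (1 - p n)))))
    std_normal_distribution"
proof (rule levy_continuity)
  have [measurable]: "random_variable borel (Y n i)" if "i \<in> {1..n}" for n i
    using indep[of n] that by (auto simp: indep_vars_def)
  let ?s = "\<lambda>n. sqrt (real n * (p n * (1 - p n)))"
  let ?W = "\<lambda>n \<omega>. ((\<Sum>i=1..n. Y n i \<omega>) - n * p n) / ?s n"
  show "real_distribution (distr M borel (?W n))" for n
    by (rule real_distribution_distr) measurable
  show "real_distribution std_normal_distribution"
    by (rule real_dist_normal_dist)
  fix t :: real
  let ?\<phi> = "\<lambda>n i. char (distr M borel (\<lambda>\<omega>. Y n i \<omega> - p n)) (t / ?s n)"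
  let ?e = "\<lambda>n. 1 + (- (t\<^sup>2) / 2) / real n"
  have char_eq: "char (distr M borel (?W n)) t = (\<Prod>i\<in>{1..n}. ?\<phi> n i)" for n
  proof -
    have "?W n = (\<lambda>\<omega>. \<Sum>i\<in>{1..n}. (Y n i \<omega> - p n) / ?s n)"
      by (auto simp: sum_divide_distrib[symmetric] sum_subtractf)
    then have "char (distr M borel (?W n)) t =
        char (distr M borel (\<lambda>\<omega>. \<Sum>i\<in>{1..n}. (Y n i \<omega> - p n) / ?s n)) t"
      by simp
    also have "\<dots> = (\<Prod>i\<in>{1..n}. char (distr M borel (\<lambda>\<omega>. (Y n i \<omega> - p n) / ?s n)) t)"
      by (rule char_distr_sum, rule indep_vars_compose2[OF indep]) measurable
    also have "\<dots> = (\<Prod>i\<in>{1..n}. ?\<phi> n i)"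
      unfolding char_def by (intro prod.cong refl) (simp add: integral_distr)
    finally show ?thesis .
  qed
  have "eventually (\<lambda>n. cmod (char (distr M borel (?W n)) t - complex_of_real (?e n ^ n))
      \<le> \<bar>t\<bar> ^ 3 / 6 / ?s n) sequentially"
    using filterlim_at_top_dense[THEN iffD1, OF sd, rule_format, of 0]
      eventually_ge_at_top[of "nat (ceiling (t\<^sup>2 / 4))"] eventually_gt_at_top[of 0]
  proof eventually_elim
    case (elim n)
    define v where "v = p n * (1 - p n)"
    have v: "0 < v" "0 < ?s n" "?s n ^ 2 = real n * v" "0 < real n"
      using elim by (auto simp: v_def zero_less_mult_iff)
    \<comment> \<open>This is exactly what keeps \<open>1 - t^2 / (2 n)\<close> at or above -1;
      comparing products termwise requires all factors to have modulus at most 1.\<close>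
    have n: "t\<^sup>2 / 4 \<le> n"
      using elim(2) by (subst nat_ceiling_le_eq[symmetric])
    have "norm (complex_of_real (?e n)) \<le> 1"
      unfolding norm_of_real using n elim(3) by (auto intro!: abs_leI simp: divide_le_eq)
    moreover have "norm (?\<phi> n i) \<le> 1" if "i \<in> {1..n}" for i
      using that by (intro real_distribution.cmod_char_le_1 real_distribution_distr) measurable
    ultimately have "cmod ((\<Prod>i\<in>{1..n}. ?\<phi> n i) - (\<Prod>i\<in>{1..n}. complex_of_real (?e n)))
        \<le> (\<Sum>i\<in>{1..n}. cmod (?\<phi> n i - complex_of_real (?e n)))"
      by (intro norm_prod_diff) auto
    also have "\<dots> \<le> (\<Sum>i\<in>{1..n}. \<bar>t / ?s n\<bar> ^ 3 * v / 6)"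
    proof (rule sum_mono)
      fix i assume i: "i \<in> {1..n}"
      have "(t / ?s n)\<^sup>2 * v = t\<^sup>2 / real n"
        unfolding power_divide v(3) using v by simp
      then have e: "?e n = 1 - (t / ?s n)\<^sup>2 * v / 2"
        by simp
      show "cmod (?\<phi> n i - complex_of_real (?e n)) \<le> \<bar>t / ?s n\<bar> ^ 3 * v / 6"
        unfolding e unfolding v_def
        by (rule char_centered_bernoulli_approx) (use i Y01 mean in auto)
    qed
    also have "\<dots> = \<bar>t\<bar> ^ 3 / 6 / ?s n"
    proof -
      have "real n * (\<bar>t / s\<bar> ^ 3 * v / 6) = \<bar>t\<bar> ^ 3 / 6 / s" if s: "0 < s" "s\<^sup>2 = real n * v" for s
      proof -
        have "real n * (\<bar>t / s\<bar> ^ 3 * v / 6) = \<bar>t\<bar> ^ 3 / 6 * ((real n * v) / s ^ 3)"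
          using s(1) by (simp add: power_divide mult_ac)
        also have "(real n * v) / s ^ 3 = 1 / s"
          unfolding s(2)[symmetric] using s(1) by (simp add: power3_eq_cube power2_eq_square)
        finally show ?thesis
          by simp
      qed
      from this[OF v(2,3)] show ?thesis
        by simp
    qed
    finally show ?case
      unfolding char_eq by simp
  qed
  moreover have "(\<lambda>n. \<bar>t\<bar> ^ 3 / 6 / ?s n) \<longlonglongrightarrow> 0"
    using sd by (intro tendsto_divide_0[OF tendsto_const] filterlim_at_top_imp_at_infinity)
  ultimately have "(\<lambda>n. char (distr M borel (?W n)) t - complex_of_real (?e n ^ n)) \<longlonglongrightarrow> 0"
    by (rule Lim_null_comparison)
  moreover have "(\<lambda>n. complex_of_real (?e n ^ n)) \<longlonglongrightarrow> complex_of_real (exp (- (t\<^sup>2) / 2))"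
    by (rule isCont_tendsto_compose[OF _ tendsto_exp_limit_sequentially]) auto
  ultimately have "(\<lambda>n. char (distr M borel (?W n)) t) \<longlonglongrightarrow> complex_of_real (exp (- (t\<^sup>2) / 2))"
    by (rule Lim_transform[rotated])
  then show "(\<lambda>n. char (distr M borel (?W n)) t) \<longlonglongrightarrow> char std_normal_distribution t"
    by (simp add: char_std_normal_distribution)
qed

section \<open>Distribution functions of normal laws\<close>

lemma normal_law_affine_image:
  assumes "s \<noteq> 0"
  shows "distr std_normal_distribution lborel (\<lambda>x. a + s * x) = normal_law a (s\<^sup>2)"
proof -
  interpret prob_space std_normal_distribution
    by (rule prob_space_normal_density) simp
  have "distributed std_normal_distribution lborel (\<lambda>x. x) std_normal_density"
    by (auto simp: distributed_def intro!: distr_id2)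
  from normal_density_affine[OF this _ assms, of a] show ?thesis
    by (simp add: distributed_def normal_law_def)
qed

lemma real_distribution_normal_law:
  assumes "s \<noteq> 0"
  shows "real_distribution (normal_law a (s\<^sup>2))"
proof -
  have "prob_space (normal_law a (s\<^sup>2))"
    using assms by (simp add: normal_law_def prob_space_normal_density)
  then show ?thesis
    by (auto simp: real_distribution_def real_distribution_axioms_def normal_law_def)
qed

text \<open>A law with a density has no atoms. Hence weak convergence to it means convergence of
  distribution functions at every point.\<close>

lemma isCont_cdf_normal_law:
  assumes "s \<noteq> 0"
  shows "isCont (cdf (normal_law a (s\<^sup>2))) x"
proof -
  interpret real_distribution "normal_law a (s\<^sup>2)"
    by (rule real_distribution_normal_law[OF assms])
  have "emeasure (normal_law a (s\<^sup>2)) {x} = 0"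
    by (subst normal_law_def, subst emeasure_density)
      (auto intro!: nn_integral_null_set simp: null_sets_def)
  then show ?thesis
    by (simp add: isCont_cdf measure_def)
qed

lemma std_normal_eq_normal_law: "std_normal_distribution = normal_law 0 1"
  by (simp add: normal_law_def)

lemma cdf_normal_law:
  assumes "s > 0"
  shows "cdf (normal_law a (s\<^sup>2)) x = cdf std_normal_distribution ((x - a) / s)"
proof -
  have "cdf (normal_law a (s\<^sup>2)) x = measure std_normal_distribution ((\<lambda>x. a + s * x) -` {..x})"
    using assms by (subst normal_law_affine_image[symmetric]) (auto simp: cdf_def measure_distr)
  also have "(\<lambda>x. a + s * x) -` {..x} = {..(x - a) / s}"
    using assms by (auto simp: field_simps)
  finally show ?thesis
    by (simp add: cdf_def)
qed

text \<open>A negative slope reverses the inequality and produces an upper half-line; its boundary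
  point carries no mass. This case serves the estimator of \<open>\<beta>\<close>, a decreasing
  function of the estimated probability.\<close>

lemma cdf_normal_law_reflect:
  assumes "s < 0"
  shows "cdf (normal_law a (s\<^sup>2)) x = 1 - cdf std_normal_distribution ((x - a) / s)"
proof -
  interpret real_distribution std_normal_distribution
    by (rule real_dist_normal_dist)
  let ?y = "(x - a) / s"
  have "cdf (normal_law a (s\<^sup>2)) x = measure std_normal_distribution ((\<lambda>x. a + s * x) -` {..x})"
    using assms by (subst normal_law_affine_image[symmetric]) (auto simp: cdf_def measure_distr)
  also have "(\<lambda>x. a + s * x) -` {..x} = UNIV - {..<?y}"
    using assms by (auto simp: field_simps)
  also have "prob (UNIV - {..<?y}) = 1 - prob {..<?y}"
    using prob_compl[of "{..<?y}"] by simp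
  also have "prob {..<?y} = cdf std_normal_distribution ?y"
  proof -
    have "prob {?y} = 0"
      using isCont_cdf_normal_law[where s=1 and a=0 and x="?y"]
      by (simp add: isCont_cdf flip: std_normal_eq_normal_law)
    moreover have "{..?y} = {..<?y} \<union> {?y}"
      by auto
    ultimately show ?thesis
      using finite_measure_Union[of "{..<?y}" "{?y}"] by (simp add: cdf_def)
  qed
  finally show ?thesis .
qed

text \<open>Eventually \<open>y n\<close> lies between \<open>z - d / 2\<close> and
  \<open>z + d / 2\<close>; monotonicity and continuity of the limiting distribution function then
  squeeze the measures. The open half-line is included because reflected events need it.\<close>

lemma weak_conv_m_moving_point:
  assumes conv: "weak_conv_m \<mu> L" and \<mu>: "\<And>n. real_distribution (\<mu> n)"
    and cont: "\<And>x. isCont (cdf L) x" and y: "y \<longlonglongrightarrow> z"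
  shows "(\<lambda>n. measure (\<mu> n) {..y n}) \<longlonglongrightarrow> cdf L z" "(\<lambda>n. measure (\<mu> n) {..<y n}) \<longlonglongrightarrow> cdf L z"
proof -
  have cdf: "(\<lambda>n. measure (\<mu> n) {..x}) \<longlonglongrightarrow> cdf L x" for x
    using conv cont[of x] by (auto simp: weak_conv_m_def weak_conv_def cdf_def)
  have mono: "measure (\<mu> n) A \<le> measure (\<mu> n) B"
    if "A \<subseteq> B" "A \<in> sets borel" "B \<in> sets borel" for A B n
  proof -
    interpret real_distribution "\<mu> n" by (rule \<mu>)
    show ?thesis
      using that by (intro finite_measure_mono) auto
  qed
  have near: "\<exists>d>0. \<forall>x. \<bar>x - z\<bar> < d \<longrightarrow> P (cdf L x)"
    if "eventually P (nhds (cdf L z))" for P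
  proof -
    have "eventually (\<lambda>x. P (cdf L x)) (nhds z)"
      using cont[of z, unfolded isCont_def tendsto_at_iff_tendsto_nhds] that
      by (simp add: filterlim_iff)
    then show ?thesis
      by (simp add: eventually_nhds_metric dist_real_def)
  qed
  have lower: "eventually (\<lambda>n. a < measure (\<mu> n) {..<y n}) sequentially" if a: "a < cdf L z" for a
  proof -
    obtain d where d: "d > 0" "\<And>x. \<bar>x - z\<bar> < d \<Longrightarrow> a < cdf L x"
      using near[OF eventually_nhds_in_open[of "{a<..}"]] a by auto
    have "eventually (\<lambda>n. z - d / 2 < y n) sequentially"
      using d(1) by (intro order_tendstoD(1)[OF y]) auto
    moreover have "eventually (\<lambda>n. a < measure (\<mu> n) {..z - d / 2}) sequentially"
      using d by (intro order_tendstoD(1)[OF cdf]) auto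
    ultimately show ?thesis
      by eventually_elim (auto elim!: less_le_trans intro!: mono)
  qed
  have upper: "eventually (\<lambda>n. measure (\<mu> n) {..y n} < b) sequentially" if b: "cdf L z < b" for b
  proof -
    obtain d where d: "d > 0" "\<And>x. \<bar>x - z\<bar> < d \<Longrightarrow> cdf L x < b"
      using near[OF eventually_nhds_in_open[of "{..<b}"]] b by auto
    have "eventually (\<lambda>n. y n < z + d / 2) sequentially"
      using d(1) by (intro order_tendstoD(2)[OF y]) auto
    moreover have "eventually (\<lambda>n. measure (\<mu> n) {..z + d / 2} < b) sequentially"
      using d by (intro order_tendstoD(2)[OF cdf]) auto
    ultimately show ?thesis
      by eventually_elim (auto elim!: le_less_trans[rotated] intro!: mono)
  qed
  have le: "measure (\<mu> n) {..<y n} \<le> measure (\<mu> n) {..y n}" for n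
    by (rule mono) auto
  show "(\<lambda>n. measure (\<mu> n) {..y n}) \<longlonglongrightarrow> cdf L z"
    using upper by (intro order_tendstoI) (auto elim!: eventually_mono[OF lower] less_le_trans intro: le)
  show "(\<lambda>n. measure (\<mu> n) {..<y n}) \<longlonglongrightarrow> cdf L z"
    using lower by (intro order_tendstoI) (auto elim!: eventually_mono[OF upper] le_less_trans[OF le])
qed

subsection \<open>Limit laws under affine and quantile transformations\<close>

text \<open>The limit law loses arbitrarily little mass beyond a suitable fixed point, and the
  diverging thresholds eventually pass that point.\<close>

lemma weak_conv_m_diverging_point:
  assumes conv: "weak_conv_m \<mu> L" and \<mu>: "\<And>n. real_distribution (\<mu> n)" and L: "real_distribution L"
    and cont: "\<And>x. isCont (cdf L) x" and a: "filterlim a at_top sequentially"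
  shows "(\<lambda>n. measure (\<mu> n) {..- a n}) \<longlonglongrightarrow> 0" "(\<lambda>n. measure (\<mu> n) {..<a n}) \<longlonglongrightarrow> 1"
proof -
  interpret L: real_distribution L
    by (rule L)
  have cdf: "(\<lambda>n. measure (\<mu> n) {..x}) \<longlonglongrightarrow> cdf L x" for x
    using weak_conv_m_moving_point(1)[OF conv \<mu> cont tendsto_const] .
  have mono: "measure (\<mu> n) A \<le> measure (\<mu> n) B" "measure (\<mu> n) A \<le> 1"
    if "A \<subseteq> B" "A \<in> sets borel" "B \<in> sets borel" for A B n
  proof -
    interpret real_distribution "\<mu> n" by (rule \<mu>)
    show "measure (\<mu> n) A \<le> measure (\<mu> n) B" "measure (\<mu> n) A \<le> 1"
      using that by (auto intro: finite_measure_mono)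
  qed
  show "(\<lambda>n. measure (\<mu> n) {..- a n}) \<longlonglongrightarrow> 0"
  proof (rule order_tendstoI)
    fix e :: real assume "0 < e"
    then have "eventually (\<lambda>x. cdf L x < e) at_bot"
      by (rule order_tendstoD(2)[OF L.cdf_lim_at_bot])
    then obtain x where x: "cdf L x < e"
      using eventually_happens trivial_limit_at_bot_linorder by blast
    have "eventually (\<lambda>n. - x \<le> a n) sequentially"
      using a by (simp add: filterlim_at_top)
    moreover have "eventually (\<lambda>n. measure (\<mu> n) {..x} < e) sequentially"
      using x by (rule order_tendstoD(2)[OF cdf])
    ultimately show "eventually (\<lambda>n. measure (\<mu> n) {..- a n} < e) sequentially"
      by eventually_elim (auto elim!: le_less_trans[rotated] intro!: mono)
  next
    fix e :: real assume "e < 0"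
    then show "eventually (\<lambda>n. e < measure (\<mu> n) {..- a n}) sequentially"
      by (intro always_eventually allI less_le_trans[OF _ measure_nonneg])
  qed
  show "(\<lambda>n. measure (\<mu> n) {..<a n}) \<longlonglongrightarrow> 1"
  proof (rule order_tendstoI)
    fix e :: real assume "e < 1"
    then have "eventually (\<lambda>x. e < cdf L x) at_top"
      by (rule order_tendstoD(1)[OF L.cdf_lim_at_top_prob])
    then obtain x where x: "e < cdf L x"
      using eventually_happens trivial_limit_at_top_linorder by blast
    have "eventually (\<lambda>n. x < a n) sequentially"
      using a by (simp add: filterlim_at_top_dense)
    moreover have "eventually (\<lambda>n. e < measure (\<mu> n) {..x}) sequentially"
      using x by (rule order_tendstoD(1)[OF cdf])
    ultimately show "eventually (\<lambda>n. e < measure (\<mu> n) {..<a n}) sequentially"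
      by eventually_elim (auto elim!: less_le_trans intro!: mono)
  next
    fix e :: real assume e: "1 < e"
    have "measure (\<mu> n) {..<a n} < e" for n
      using mono(2)[of "{..<a n}" UNIV n] e by simp
    then show "eventually (\<lambda>n. measure (\<mu> n) {..<a n} < e) sequentially"
      by simp
  qed
qed

lemma (in prob_space) cdf_distr_eq:
  "random_variable borel X \<Longrightarrow> cdf (distr M borel X) x = prob {\<omega> \<in> space M. X \<omega> \<le> x}"
  by (auto simp: cdf_def measure_distr intro!: arg_cong[of _ _ prob])

text \<open>A Slutsky argument for deterministic coefficients: solving
  \<open>Z n \<omega> \<le> x\<close> for \<open>W n \<omega>\<close> gives the threshold
  \<open>(x - b n) / s n\<close>, which converges because \<open>s0\<close> is positive.\<close>

lemma (in prob_space) weak_conv_m_affine_normal: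
  assumes W [measurable]: "\<And>n. random_variable borel (W n)"
    and Z [measurable]: "\<And>n. random_variable borel (Z n)"
    and conv: "weak_conv_m (\<lambda>n. distr M borel (W n)) std_normal_distribution"
    and b: "b \<longlonglongrightarrow> b0" and s: "s \<longlonglongrightarrow> s0" "0 < s0"
    and eq: "eventually (\<lambda>n. \<forall>\<omega>\<in>space M. Z n \<omega> = b n + s n * W n \<omega>) sequentially"
  shows "weak_conv_m (\<lambda>n. distr M borel (Z n)) (normal_law b0 (s0\<^sup>2))"
  unfolding weak_conv_m_def weak_conv_def
proof (intro allI impI)
  fix x
  have "(\<lambda>n. measure (distr M borel (W n)) {..(x - b n) / s n}) \<longlonglongrightarrow>
      cdf std_normal_distribution ((x - b0) / s0)"
  proof (rule weak_conv_m_moving_point(1)[OF conv])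
    show "isCont (cdf std_normal_distribution) y" for y
      using isCont_cdf_normal_law[where s=1 and a=0 and x=y] by (simp flip: std_normal_eq_normal_law)
    show "(\<lambda>n. (x - b n) / s n) \<longlonglongrightarrow> (x - b0) / s0"
      using b s by (intro tendsto_intros) auto
  qed (rule real_distribution_distr[OF W])
  moreover have "eventually (\<lambda>n. measure (distr M borel (W n)) {..(x - b n) / s n} =
      cdf (distr M borel (Z n)) x) sequentially"
    using eq order_tendstoD(1)[OF s]
  proof eventually_elim
    case (elim n)
    have "{\<omega> \<in> space M. W n \<omega> \<le> (x - b n) / s n} = {\<omega> \<in> space M. Z n \<omega> \<le> x}"
      using elim by (auto simp: field_simps)
    then show ?case
      unfolding cdf_def2[symmetric] by (simp add: cdf_distr_eq)
  qed
  ultimately have "(\<lambda>n. cdf (distr M borel (Z n)) x) \<longlonglongrightarrow> cdf std_normal_distribution ((x - b0) / s0)"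
    by (rule Lim_transform_eventually)
  then show "(\<lambda>n. cdf (distr M borel (Z n)) x) \<longlonglongrightarrow> cdf (normal_law b0 (s0\<^sup>2)) x"
    by (simp add: cdf_normal_law s)
qed

lemma (in prob_space) prob_diff_le:
  assumes "A \<in> events" "B \<in> events" "C \<in> events" "A - C = B - C"
  shows "\<bar>prob A - prob B\<bar> \<le> prob C"
proof -
  have "prob A \<le> prob (B \<union> C)" "prob B \<le> prob (A \<union> C)"
    using assms by (auto intro!: finite_measure_mono)
  then show ?thesis
    using measure_Un_le[of B M C] measure_Un_le[of A M C] assms by linarith
qed

text \<open>Since \<open>- 2 * quantile_fun \<psi> q \<le> z\<close> iff \<open>dist_fun \<psi> (- z / 2) \<le> q\<close>, the event that the
  transformed estimator is small is the event that \<open>q\<close> exceeds a threshold, and the derivative of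
  \<open>dist_fun \<psi>\<close> gives the limit of the rescaled threshold.\<close>

lemma (in prob_space) weak_conv_m_quantile_normal:
  assumes psi: "admissible_density \<psi>"
    and q [measurable]: "\<And>n. random_variable borel (q n)"
    and T [measurable]: "\<And>n. random_variable borel (T n)"
    and R: "filterlim R at_top sequentially"
    and conv: "weak_conv_m (\<lambda>n. distr M borel (\<lambda>\<omega>. R n * (q n \<omega> - dist_fun \<psi> y0))) (normal_law b (s\<^sup>2))"
    and s: "0 < s"
    and T_eq: "\<And>n \<omega>. \<omega> \<in> space M \<Longrightarrow> q n \<omega> \<in> {0<..<1} \<Longrightarrow>
      T n \<omega> = R n * (- 2 * quantile_fun \<psi> (q n \<omega>) + 2 * y0)"
  shows "weak_conv_m (\<lambda>n. distr M borel (T n)) (normal_law (- (2 * b) / \<psi> y0) ((- 2 * s / \<psi> y0)\<^sup>2))"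
  unfolding weak_conv_m_def weak_conv_def
proof (intro allI impI)
  fix y
  let ?\<Psi> = "dist_fun \<psi>" and ?L = "normal_law b (s\<^sup>2)"
  let ?Z = "\<lambda>n \<omega>. R n * (q n \<omega> - ?\<Psi> y0)"
  let ?z = "\<lambda>n. R n * (?\<Psi> (y0 - y / 2 * (1 / R n)) - ?\<Psi> y0)"
  note pos = admissible_density_pos[OF psi, of y0]
  note bounds = dist_fun_bounds[OF psi, of y0]
  have [measurable]: "random_variable borel (?Z n)" for n
    by measurable
  have \<mu>: "real_distribution (distr M borel (?Z n))" for n
    by (rule real_distribution_distr) measurable
  have L: "real_distribution ?L"
    using s by (intro real_distribution_normal_law) auto
  have cont: "isCont (cdf ?L) x" for x
    using s by (intro isCont_cdf_normal_law) auto
  have Z_lt: "measure (distr M borel (?Z n)) {..<x} = prob {\<omega> \<in> space M. ?Z n \<omega> < x}" for n x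
    by (auto simp: measure_distr intro!: arg_cong[of _ _ prob])
  have R_pos: "eventually (\<lambda>n. 0 < R n) sequentially"
    using R by (simp add: filterlim_at_top_dense)

  \<comment> \<open>With \<open>h = 1 / R n\<close>, the threshold \<open>?z n\<close> is a
    difference quotient of this function at 0.\<close>
  have "((\<lambda>h. ?\<Psi> (y0 - y / 2 * h)) has_real_derivative \<psi> (y0 - y / 2 * 0) * (- (y / 2))) (at 0)"
    by (rule DERIV_chain2[OF dist_fun_has_derivative[OF psi]]) (auto intro!: derivative_eq_intros)
  then have "((\<lambda>h. (?\<Psi> (y0 - y / 2 * h) - ?\<Psi> y0) / h) \<longlongrightarrow> - y * \<psi> y0 / 2) (at 0)"
    by (simp add: DERIV_def mult.commute)
  moreover have "filterlim (\<lambda>n. 1 / R n) (at 0) sequentially"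
    unfolding filterlim_at using R_pos
    by (auto intro!: tendsto_divide_0[OF tendsto_const] filterlim_at_top_imp_at_infinity R elim: eventually_mono)
  ultimately have "(\<lambda>n. (?\<Psi> (y0 - y / 2 * (1 / R n)) - ?\<Psi> y0) / (1 / R n)) \<longlonglongrightarrow> - y * \<psi> y0 / 2"
    by (rule filterlim_compose)
  then have z: "?z \<longlonglongrightarrow> - y * \<psi> y0 / 2"
    by (simp add: mult.commute)

  have "(\<lambda>n. 1 - prob {\<omega> \<in> space M. ?Z n \<omega> < ?z n}) \<longlonglongrightarrow> 1 - cdf ?L (- y * \<psi> y0 / 2)"
    using weak_conv_m_moving_point(2)[OF conv \<mu> cont z] unfolding Z_lt by (intro tendsto_intros)
  also have "1 - cdf ?L (- y * \<psi> y0 / 2) = cdf (normal_law (- (2 * b) / \<psi> y0) ((- 2 * s / \<psi> y0)\<^sup>2)) y"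
  proof -
    have "(- y * \<psi> y0 / 2 - b) / s = (y - - (2 * b) / \<psi> y0) / (- 2 * s / \<psi> y0)"
      using s pos by (simp add: field_simps)
    moreover have "- 2 * s / \<psi> y0 < 0"
      using s pos by (simp add: divide_simps)
    ultimately show ?thesis
      using s by (simp only: cdf_normal_law cdf_normal_law_reflect)
  qed
  finally have main: "(\<lambda>n. 1 - prob {\<omega> \<in> space M. ?Z n \<omega> < ?z n}) \<longlonglongrightarrow>
      cdf (normal_law (- (2 * b) / \<psi> y0) ((- 2 * s / \<psi> y0)\<^sup>2)) y" .

  \<comment> \<open>On this event \<open>T n\<close> is unrestricted. There \<open>?Z n\<close> is
    either at most \<open>- (R n * ?\<Psi> y0)\<close> or at least
    \<open>R n * (1 - ?\<Psi> y0)\<close>; both thresholds diverge, so the probability tends to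
    0.\<close>
  let ?C = "\<lambda>n. {\<omega> \<in> space M. q n \<omega> \<notin> {0<..<1}}"
  have prob_C: "(\<lambda>n. prob (?C n)) \<longlonglongrightarrow> 0"
  proof (rule Lim_null_comparison)
    have lo: "filterlim (\<lambda>n. R n * ?\<Psi> y0) at_top sequentially"
      and hi: "filterlim (\<lambda>n. R n * (1 - ?\<Psi> y0)) at_top sequentially"
      using bounds by (auto intro!: filterlim_at_top_mult_tendsto_pos[OF tendsto_const _ R])
    have "(\<lambda>n. measure (distr M borel (?Z n)) {..- (R n * ?\<Psi> y0)} +
        (1 - measure (distr M borel (?Z n)) {..<R n * (1 - ?\<Psi> y0)})) \<longlonglongrightarrow> 0 + (1 - 1)"
      by (intro tendsto_intros weak_conv_m_diverging_point[OF conv \<mu> L cont] lo hi)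
    then show "(\<lambda>n. measure (distr M borel (?Z n)) {..- (R n * ?\<Psi> y0)} +
        (1 - measure (distr M borel (?Z n)) {..<R n * (1 - ?\<Psi> y0)})) \<longlonglongrightarrow> 0"
      by simp
    show "eventually (\<lambda>n. norm (prob (?C n)) \<le> measure (distr M borel (?Z n)) {..- (R n * ?\<Psi> y0)} +
        (1 - measure (distr M borel (?Z n)) {..<R n * (1 - ?\<Psi> y0)})) sequentially"
      using R_pos
    proof eventually_elim
      case (elim n)
      let ?A = "{\<omega> \<in> space M. ?Z n \<omega> \<le> - (R n * ?\<Psi> y0)}"
      let ?B = "{\<omega> \<in> space M. ?Z n \<omega> < R n * (1 - ?\<Psi> y0)}"
      have "?C n \<subseteq> ?A \<union> (space M - ?B)"
      proof
        fix \<omega> assume \<omega>: "\<omega> \<in> ?C n"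
        show "\<omega> \<in> ?A \<union> (space M - ?B)"
        proof (cases "q n \<omega> \<le> 0")
          case True
          then have "R n * q n \<omega> \<le> 0"
            using elim by (simp add: mult_le_0_iff)
          then show ?thesis
            using \<omega> by (simp add: algebra_simps)
        next
          case False
          then have "R n * 1 \<le> R n * q n \<omega>"
            using elim \<omega> by (intro mult_left_mono) auto
          then show ?thesis
            using \<omega> by (simp add: algebra_simps)
        qed
      qed
      then have "prob (?C n) \<le> prob (?A \<union> (space M - ?B))"
        by (intro finite_measure_mono) auto
      also have "\<dots> \<le> prob ?A + prob (space M - ?B)"
        by (intro measure_Un_le) auto
      also have "prob (space M - ?B) = 1 - prob ?B"
        by (rule prob_compl) auto
      finally show ?case
        unfolding Z_lt cdf_def2[symmetric] by (simp add: cdf_distr_eq)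
    qed
  qed

  have "(\<lambda>n. cdf (distr M borel (T n)) y - (1 - prob {\<omega> \<in> space M. ?Z n \<omega> < ?z n})) \<longlonglongrightarrow> 0"
  proof (rule Lim_null_comparison[OF _ prob_C])
    show "eventually (\<lambda>n. norm (cdf (distr M borel (T n)) y -
        (1 - prob {\<omega> \<in> space M. ?Z n \<omega> < ?z n})) \<le> prob (?C n)) sequentially"
      using R_pos
    proof eventually_elim
      case (elim n)
      have "T n \<omega> \<le> y \<longleftrightarrow> \<not> ?Z n \<omega> < ?z n" if \<omega>: "\<omega> \<in> space M" "q n \<omega> \<in> {0<..<1}" for \<omega>
      proof -
        have "T n \<omega> \<le> y \<longleftrightarrow> y0 - y / 2 * (1 / R n) \<le> quantile_fun \<psi> (q n \<omega>)"
          unfolding T_eq[OF \<omega>] using elim by (simp add: field_simps)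
        also have "\<dots> \<longleftrightarrow> ?\<Psi> (y0 - y / 2 * (1 / R n)) \<le> q n \<omega>"
          by (rule le_quantile_fun_iff[OF psi \<omega>(2)])
        also have "\<dots> \<longleftrightarrow> \<not> ?Z n \<omega> < ?z n"
          using elim by (simp add: not_less)
        finally show ?thesis .
      qed
      then have "{\<omega> \<in> space M. T n \<omega> \<le> y} - ?C n =
          (space M - {\<omega> \<in> space M. ?Z n \<omega> < ?z n}) - ?C n"
        by auto
      then have "\<bar>prob {\<omega> \<in> space M. T n \<omega> \<le> y} -
          prob (space M - {\<omega> \<in> space M. ?Z n \<omega> < ?z n})\<bar> \<le> prob (?C n)"
        by (intro prob_diff_le) auto
      then show ?case
        by (simp add: cdf_distr_eq prob_compl)
    qed
  qed
  from tendsto_add[OF this main]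
  show "(\<lambda>n. cdf (distr M borel (T n)) y) \<longlonglongrightarrow>
      cdf (normal_law (- (2 * b) / \<psi> y0) ((- 2 * s / \<psi> y0)\<^sup>2)) y"
    by simp
qed

subsection \<open>Asymptotic normality of the estimators\<close>

theorem theorem3p3:
  fixes \<psi> :: "real \<Rightarrow> real"
    and \<beta> \<delta> \<epsilon>0 \<kappa> \<mu> :: real
    and MX :: "'x measure" and X :: "real \<Rightarrow> 'x \<Rightarrow> real"
    and M\<eta> :: "'e measure" and \<eta> :: "real \<Rightarrow> 'e \<Rightarrow> real"
    and MV :: "'v measure" and V :: "real \<Rightarrow> 'v \<Rightarrow> real"
    and M :: "'m measure" and Xs :: "nat \<Rightarrow> real \<Rightarrow> 'm \<Rightarrow> real"
    and K :: "(real \<Rightarrow> real) \<Rightarrow> real"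
    and r :: "real \<Rightarrow> (real \<Rightarrow> real) \<Rightarrow> real"
    and c :: "nat \<Rightarrow> real"
    and v :: "real \<Rightarrow> nat \<Rightarrow> real \<Rightarrow> real"
  assumes psi: "admissible_density \<psi>"
    and beta_pos: "\<beta> > 0" and delta_pos: "\<delta> > 0"
    and evp: "EVP_with_parameter \<beta> \<psi> M\<eta> \<eta>"
    and gpp: "standard_GPP \<beta> \<psi> M\<eta> \<eta> MV V"
    and X_process: "process_with_paths_in Cbar_minus MX X"
    and eps0_pos: "\<epsilon>0 > 0"
    and expansion: "\<And>a f. a \<in> {0<..<1} \<Longrightarrow> f \<in> Ebar_minus \<Longrightarrow> sup_norm01 f \<le> \<epsilon>0 \<Longrightarrow>
      prob_gt MX X (\<lambda>t. a * f t) =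
        prob_gt MV V (\<lambda>t. a * f t) * (1 + a powr \<delta> * K f + r a f)"
    and remainder: "\<And>f. f \<in> Ebar_minus \<Longrightarrow> sup_norm01 f \<le> \<epsilon>0 \<Longrightarrow>
      (\<lambda>a. r a f) \<in> o[at_right 0](\<lambda>a. a powr \<delta>)"
    \<comment> \<open>For \<open>\<epsilon>0 < 1\<close> the expansion does not involve the constant function \<open>-1\<close>; \<open>K(-1)\<close> is then
      the extension of \<open>K\<close> by the homogeneity of order \<open>\<delta>\<close> which the expansion forces along rays.\<close>
    and K_minus_one: "\<epsilon>0 < 1 \<Longrightarrow> K (\<lambda>_. - \<epsilon>0) = \<epsilon>0 powr \<delta> * K (\<lambda>_. - 1)"
    and copies: "independent_copies Cbar_minus MX X M Xs"
    and c_neg: "\<And>n. n \<ge> 1 \<Longrightarrow> c n < 0"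
    and c_lim: "c \<longlonglongrightarrow> 0"
    and nc_lim: "filterlim (\<lambda>n. real n * \<bar>c n\<bar>) at_top sequentially"
    and bias_lim: "(\<lambda>n. real n * \<bar>c n\<bar> powr (1 + 2 * \<delta>)) \<longlonglongrightarrow> \<kappa>"
    and kappa_nonneg: "\<kappa> \<ge> 0"
    and mu: "\<mu> = K (\<lambda>_. - 1) * dist_fun \<psi> (- \<beta> / 2)"
  shows "converges_in_distribution M
      (\<lambda>n \<omega>. sqrt (real n * \<bar>c n\<bar>) * (Psi_hat Xs (c n) n \<omega> - dist_fun \<psi> (- \<beta> / 2)))
      (normal_law (sqrt \<kappa> * \<mu>) (1 / 2 * dist_fun \<psi> (- \<beta> / 2)))
    \<and> converges_in_distribution M
      (\<lambda>n \<omega>. sqrt (real n * \<bar>c n\<bar>) * (beta_hat v \<psi> Xs (c n) n \<omega> - \<beta>))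
      (normal_law (- (2 * sqrt \<kappa> * \<mu>) / \<psi> (- \<beta> / 2))
        (2 * dist_fun \<psi> (- \<beta> / 2) / (\<psi> (- \<beta> / 2))\<^sup>2))"
proof -
  let ?\<Psi>0 = "dist_fun \<psi> (- \<beta> / 2)"
  let ?R = "\<lambda>n. sqrt (real n * \<bar>c n\<bar>)"
  define K1 where "K1 = K (\<lambda>_. - 1)"
  note pos = admissible_density_pos[OF psi, of "- \<beta> / 2"]
  note bounds = dist_fun_bounds[OF psi, of "- \<beta> / 2"]
  have Cbar: "Cbar_minus \<subseteq> C01"
    by (auto simp: Cbar_minus_def)
  have Xs_process: "process_with_paths_in C01 M (Xs i)" if "i \<ge> 1" for i
    using copies that process_with_paths_in_mono[OF _ Cbar]
    unfolding independent_copies_def by blast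
  interpret prob_space M
    using Xs_process[of 1] by (simp add: process_with_paths_in_def)

  \<comment> \<open>Exceedance indicators as independent Bernoulli variables\<close>
  define p where "p n = prob_gt MX X (\<lambda>_. c n)" for n
  \<comment> \<open>Factoring the indicator through the path map lets independence and equality of
    laws on the path space pass to the summands.\<close>
  define Y where "Y n i \<omega> = (indicator (paths_above (c n)) (path (Xs i) \<omega>) :: real)" for n i \<omega>
  define S where "S n \<omega> = (\<Sum>i=1..n. Y n i \<omega>)" for n \<omega>
  have Y_rv [measurable]: "random_variable borel (Y n i)" if "i \<ge> 1" for n i
    unfolding Y_def[abs_def]
    by (rule measurable_compose[OF path_measurable[OF Xs_process[OF that]]]) measurable
  have indep: "indep_vars (\<lambda>_. borel) (Y n) {1..n}" for n
  proof -
    have "indep_vars (\<lambda>_. path_space) (\<lambda>i. path (Xs i)) {1..n}"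
      using copies unfolding independent_copies_def by (auto intro: indep_vars_subset)
    then show ?thesis
      unfolding Y_def[abs_def] by (rule indep_vars_compose2) measurable
  qed
  have mean: "expectation (Y n i) = p n" if "i \<ge> 1" for n i
  proof -
    have "distr M path_space (path (Xs i)) = distr MX path_space (path X)"
      using copies that unfolding independent_copies_def by blast
    then have "p n = measure (distr M path_space (path (Xs i))) (paths_above (c n))"
      using prob_gt_const_eq_distr[OF process_with_paths_in_mono[OF X_process Cbar]]
      by (simp add: p_def)
    also have "\<dots> = integral\<^sup>L (distr M path_space (path (Xs i))) (indicator (paths_above (c n)))"
      using sets.sets_into_space[OF sets_paths_above[of "c n"]] by (simp add: Int_absorb2)
    also have "\<dots> = expectation (Y n i)"
      unfolding Y_def[abs_def]
      by (rule integral_distr[OF path_measurable[OF Xs_process[OF that]]]) measurable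
    finally show ?thesis ..
  qed
  have S_eq: "Psi_hat Xs (c n) n \<omega> = 1 / (2 * \<bar>c n\<bar> * real n) * S n \<omega>" if "\<omega> \<in> space M" for n \<omega>
    unfolding Psi_hat_def S_def
    by (intro arg_cong2[of _ _ _ _ "(*)"] sum.cong refl)
      (simp add: Y_def indicator_def path_in_paths_above_iff[OF Xs_process that])
  have [measurable]: "random_variable borel (S n)" for n
    unfolding S_def[abs_def] by (intro borel_measurable_sum Y_rv) auto
  have Psi_hat_rv [measurable]: "random_variable borel (Psi_hat Xs (c n) n)" for n
    by (subst measurable_cong[OF S_eq]) measurable

  \<comment> \<open>Expansion of the success probability\<close>
  define h where "h = min 1 \<epsilon>0"
  \<comment> \<open>The expansion is available for functions of norm at most
    \<open>\<epsilon>0\<close>, hence for the constant \<open>- h\<close>; at scale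
    \<open>\<bar>c n\<bar> / h\<close> it describes the level \<open>c n\<close>. The factor
    \<open>h powr \<delta>\<close> from the homogeneity of \<open>K\<close> cancels against the
    scale.\<close>
  define \<rho> where "\<rho> n = r (\<bar>c n\<bar> / h) (\<lambda>_. - h)" for n
  have h: "0 < h" "h \<le> \<epsilon>0"
    using eps0_pos by (auto simp: h_def)
  have Kh: "K (\<lambda>_. - h) = h powr \<delta> * K1"
    using K_minus_one by (cases "\<epsilon>0 < 1") (auto simp: h_def K1_def)
  have h_fun: "(\<lambda>_. - h) \<in> Ebar_minus" "sup_norm01 (\<lambda>_. - h) \<le> \<epsilon>0"
    using h const_in_Ebar_minus[of "- h"] by (auto simp: sup_norm01_const)
  have abs_c: "(\<lambda>n. \<bar>c n\<bar>) \<longlonglongrightarrow> 0"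
    using tendsto_rabs[OF c_lim] by simp
  have c_ev: "eventually (\<lambda>n. 0 < real n \<and> c n < 0) sequentially"
    using eventually_ge_at_top[of 1] by eventually_elim (auto intro: c_neg)
  have a_lim: "filterlim (\<lambda>n. \<bar>c n\<bar> / h) (at_right 0) sequentially"
    unfolding filterlim_at
  proof (intro conjI)
    show "(\<lambda>n. \<bar>c n\<bar> / h) \<longlonglongrightarrow> 0"
      using tendsto_divide_zero[OF abs_c] by simp
    show "eventually (\<lambda>n. \<bar>c n\<bar> / h \<in> {0<..} \<and> \<bar>c n\<bar> / h \<noteq> 0) sequentially"
      using c_ev by eventually_elim (use h in \<open>auto simp: divide_neg_pos\<close>)
  qed
  define \<tau> where "\<tau> n = \<rho> n / \<bar>c n\<bar> powr \<delta>" for n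
  have \<tau>: "\<tau> \<longlonglongrightarrow> 0"
  proof -
    have "((\<lambda>a. r a (\<lambda>_. - h) / a powr \<delta>) \<longlongrightarrow> 0) (at_right 0)"
      by (rule smalloD_tendsto[OF remainder[OF h_fun]])
    then have "(\<lambda>n. r (\<bar>c n\<bar> / h) (\<lambda>_. - h) / (\<bar>c n\<bar> / h) powr \<delta>) \<longlonglongrightarrow> 0"
      using a_lim by (rule filterlim_compose)
    then have "(\<lambda>n. r (\<bar>c n\<bar> / h) (\<lambda>_. - h) / (\<bar>c n\<bar> / h) powr \<delta> / h powr \<delta>) \<longlonglongrightarrow> 0"
      by (rule tendsto_divide_zero)
    then show ?thesis
      using h(1) by (simp add: \<tau>_def[abs_def] \<rho>_def powr_divide)
  qed

  obtain x0 where x0: "x0 > 0" and gpp_eq: "\<And>f. f \<in> Ebar_minus \<Longrightarrow> sup_norm01 f \<le> x0 \<Longrightarrow>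
      prob_le MV V f = 1 - (LINT s|lborel. (SUP t\<in>{0..1}. \<bar>f t\<bar> * \<psi> (s - \<beta> * t)))"
    and V_process: "process_with_paths_in C01 MV V"
    using gpp unfolding standard_GPP_def by blast
  have "prob_space MV"
    using V_process by (simp add: process_with_paths_in_def)
  then interpret V: gpp_process MV \<beta> \<psi> V x0
    by (intro gpp_process.intro gpp_process_axioms.intro psi beta_pos x0 V_process gpp_eq)
  \<comment> \<open>Eventually \<open>\<bar>c n\<bar>\<close> is below \<open>h\<close>, so the
    scale lies in \<open>{0<..<1}\<close>, and below \<open>x0\<close>, so the exact formula for
    \<open>V\<close> applies.\<close>
  have p_ev: "eventually (\<lambda>n. p n = 2 * \<bar>c n\<bar> * ?\<Psi>0 * (1 + \<bar>c n\<bar> powr \<delta> * (K1 + \<tau> n))) sequentially"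
    using c_ev order_tendstoD(2)[OF abs_c h(1)] order_tendstoD(2)[OF abs_c x0]
  proof eventually_elim
    case (elim n)
    let ?a = "\<bar>c n\<bar> / h"
    have a: "?a \<in> {0<..<1}" "?a * - h = c n"
      using elim h(1) by (auto simp: field_simps)
    have "p n = prob_gt MX X (\<lambda>t. ?a * - h)"
      unfolding a(2) by (simp add: p_def)
    also have "\<dots> = prob_gt MV V (\<lambda>t. ?a * - h) * (1 + ?a powr \<delta> * K (\<lambda>_. - h) + r ?a (\<lambda>_. - h))"
      by (rule expansion[OF a(1) h_fun])
    also have "prob_gt MV V (\<lambda>t. ?a * - h) = 2 * \<bar>c n\<bar> * ?\<Psi>0"
      unfolding a(2) using elim by (intro V.prob_gt_const) auto
    also have "?a powr \<delta> * K (\<lambda>_. - h) = \<bar>c n\<bar> powr \<delta> * K1"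
      using h(1) by (simp add: Kh powr_divide)
    also have "r ?a (\<lambda>_. - h) = \<bar>c n\<bar> powr \<delta> * \<tau> n"
      using elim by (simp add: \<tau>_def \<rho>_def)
    finally show ?case
      by (simp add: algebra_simps)
  qed

  have c_powr: "(\<lambda>n. \<bar>c n\<bar> powr \<delta>) \<longlonglongrightarrow> 0"
    using tendsto_zero_powrI[OF abs_c tendsto_const _ delta_pos] by simp
  have p_ratio: "(\<lambda>n. p n / \<bar>c n\<bar>) \<longlonglongrightarrow> 2 * ?\<Psi>0"
  proof (rule Lim_transform_eventually)
    show "(\<lambda>n. 2 * ?\<Psi>0 * (1 + \<bar>c n\<bar> powr \<delta> * (K1 + \<tau> n))) \<longlonglongrightarrow> 2 * ?\<Psi>0"
      by (rule tendsto_eq_intros c_powr \<tau> refl)+ simp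
    show "eventually (\<lambda>n. 2 * ?\<Psi>0 * (1 + \<bar>c n\<bar> powr \<delta> * (K1 + \<tau> n)) = p n / \<bar>c n\<bar>) sequentially"
      using p_ev c_ev by eventually_elim simp
  qed
  have p_lim: "p \<longlonglongrightarrow> 0"
  proof (rule Lim_transform_eventually)
    show "(\<lambda>n. p n / \<bar>c n\<bar> * \<bar>c n\<bar>) \<longlonglongrightarrow> 0"
      using tendsto_mult[OF p_ratio abs_c] by simp
    show "eventually (\<lambda>n. p n / \<bar>c n\<bar> * \<bar>c n\<bar> = p n) sequentially"
      using c_ev by eventually_elim simp
  qed
  have R_lim: "filterlim ?R at_top sequentially"
    by (rule filterlim_compose[OF sqrt_at_top nc_lim])

  \<comment> \<open>Bias and standard deviation\<close>
  define b where "b n = ?R n * (p n / (2 * \<bar>c n\<bar>) - ?\<Psi>0)" for n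
  define sd where "sd n = sqrt (real n * (p n * (1 - p n)))" for n
  define s where "s n = sqrt (p n / \<bar>c n\<bar> * (1 - p n)) / 2" for n
  define s0 where "s0 = sqrt (2 * ?\<Psi>0) / 2"
  have s0: "0 < s0" "s0\<^sup>2 = 1 / 2 * ?\<Psi>0"
    using bounds by (auto simp: s0_def power_divide)
  \<comment> \<open>The rate times the relative bias has order
    \<open>?R n * \<bar>c n\<bar> powr \<delta>\<close>, which is the square root of the sequence in
    \<open>bias_lim\<close>.\<close>
  have b_lim: "b \<longlonglongrightarrow> sqrt \<kappa> * \<mu>"
  proof (rule Lim_transform_eventually)
    have "(\<lambda>n. sqrt (real n * \<bar>c n\<bar> powr (1 + 2 * \<delta>)) * (?\<Psi>0 * (K1 + \<tau> n))) \<longlonglongrightarrow>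
        sqrt \<kappa> * (?\<Psi>0 * (K1 + 0))"
      by (intro tendsto_intros \<tau> bias_lim)
    then show "(\<lambda>n. sqrt (real n * \<bar>c n\<bar> powr (1 + 2 * \<delta>)) * (?\<Psi>0 * (K1 + \<tau> n))) \<longlonglongrightarrow> sqrt \<kappa> * \<mu>"
      by (simp add: mu K1_def mult.commute)
    show "eventually (\<lambda>n. sqrt (real n * \<bar>c n\<bar> powr (1 + 2 * \<delta>)) * (?\<Psi>0 * (K1 + \<tau> n)) = b n) sequentially"
      using p_ev c_ev
    proof eventually_elim
      case (elim n)
      have "real n * \<bar>c n\<bar> powr (1 + 2 * \<delta>) = (real n * \<bar>c n\<bar>) * (\<bar>c n\<bar> powr \<delta>)\<^sup>2"
        by (simp only: mult_2 powr_add power2_eq_square powr_one[OF abs_ge_zero] mult.assoc)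
      then have "sqrt (real n * \<bar>c n\<bar> powr (1 + 2 * \<delta>)) = ?R n * \<bar>c n\<bar> powr \<delta>"
        by (simp only: real_sqrt_mult real_sqrt_abs) simp
      moreover have "p n / (2 * \<bar>c n\<bar>) - ?\<Psi>0 = \<bar>c n\<bar> powr \<delta> * (?\<Psi>0 * (K1 + \<tau> n))"
        using elim by (simp add: field_simps)
      ultimately show ?case
        by (simp only: b_def mult.assoc)
    qed
  qed
  have s_lim: "s \<longlonglongrightarrow> s0"
  proof -
    have "(\<lambda>n. sqrt (p n / \<bar>c n\<bar> * (1 - p n)) / 2) \<longlonglongrightarrow> sqrt (2 * ?\<Psi>0 * (1 - 0)) / 2"
      by (intro tendsto_intros p_ratio p_lim) simp
    then show ?thesis
      by (simp add: s_def[abs_def] s0_def)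
  qed
  have sd_eq: "eventually (\<lambda>n. 2 * s n * ?R n = sd n) sequentially"
    using c_ev
  proof eventually_elim
    case (elim n)
    have "2 * s n * ?R n = sqrt (p n / \<bar>c n\<bar> * (1 - p n) * (real n * \<bar>c n\<bar>))"
      unfolding s_def real_sqrt_mult[of "p n / \<bar>c n\<bar> * (1 - p n)"] by simp
    also have "p n / \<bar>c n\<bar> * (1 - p n) * (real n * \<bar>c n\<bar>) = real n * (p n * (1 - p n))"
      using elim by simp
    finally show ?case
      by (simp only: sd_def)
  qed
  have sd_lim: "filterlim sd at_top sequentially"
  proof (rule filterlim_mono_eventually[OF _ order_refl order_refl sd_eq])
    have "(\<lambda>n. 2 * s n) \<longlonglongrightarrow> 2 * s0"
      by (intro tendsto_intros s_lim)
    then show "filterlim (\<lambda>n. 2 * s n * ?R n) at_top sequentially"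
      using s0(1) R_lim by (intro filterlim_tendsto_pos_mult_at_top[of _ "2 * s0"]) auto
  qed

  \<comment> \<open>Limit laws of the two estimators\<close>
  let ?W = "\<lambda>n \<omega>. (S n \<omega> - n * p n) / sd n"
  let ?Z = "\<lambda>n \<omega>. ?R n * (Psi_hat Xs (c n) n \<omega> - ?\<Psi>0)"
  let ?T = "\<lambda>n \<omega>. ?R n * (beta_hat v \<psi> Xs (c n) n \<omega> - \<beta>)"
  have W_conv: "weak_conv_m (\<lambda>n. distr M borel (?W n)) std_normal_distribution"
    unfolding S_def sd_def
    by (rule de_Moivre_Laplace[OF indep _ _ sd_lim[unfolded sd_def[abs_def]]])
      (auto simp: mean Y_def indicator_def)
  have Z_conv: "weak_conv_m (\<lambda>n. distr M borel (?Z n)) (normal_law (sqrt \<kappa> * \<mu>) (s0\<^sup>2))"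
  proof (rule weak_conv_m_affine_normal[OF _ _ W_conv b_lim s_lim s0(1)])
    show "eventually (\<lambda>n. \<forall>\<omega>\<in>space M. ?Z n \<omega> = b n + s n * ?W n \<omega>) sequentially"
      using sd_eq c_ev filterlim_at_top_dense[THEN iffD1, OF sd_lim, rule_format, of 0]
    proof eventually_elim
      case (elim n)
      \<comment> \<open>The scalars stand for \<open>?R n\<close>, \<open>\<bar>c n\<bar>\<close>,
        \<open>real n\<close>, \<open>S n \<omega>\<close>, \<open>p n\<close>, \<open>s n\<close>
        and \<open>sd n\<close>; abstracting them turns the square root into the relation
        \<open>R * R = m * a\<close>.\<close>
      have affine: "R * (1 / (2 * a * m) * x - \<Psi>0) = R * (q / (2 * a) - \<Psi>0) + t * ((x - m * q) / d)"
        if "0 < R" "R * R = m * a" "0 < m" "0 < d" "2 * t * R = d" for R a m x q t d \<Psi>0 :: real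
      proof -
        have a: "a = R * R / m" and t: "t = d / (2 * R)"
          using that by (simp_all add: field_simps)
        show ?thesis
          unfolding a t using that(1,3,4) by (simp add: field_simps)
      qed
      have R: "0 < ?R n" "?R n * ?R n = real n * \<bar>c n\<bar>"
        using elim(2) by (auto simp: mult_pos_neg abs_mult)
      show ?case
      proof
        fix \<omega> assume \<omega>: "\<omega> \<in> space M"
        show "?Z n \<omega> = b n + s n * ?W n \<omega>"
          unfolding S_eq[OF \<omega>] b_def by (rule affine[OF R _ elim(3,1)]) (use elim(2) in blast)
      qed
    qed
  qed measurable
  \<comment> \<open>The default \<open>v\<close> is arbitrary and need not be measurable.
    Measurability holds because \<open>Psi_hat\<close> takes finitely many values, so any function
    of it is simple.\<close>
  have T_rv: "random_variable borel (?T n)" for n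
  proof -
    define g where "g q = (if q \<in> {0<..<1} then - 2 * quantile_fun \<psi> q else v (c n) n q)" for q
    have "Psi_hat Xs (c n) n ` space M \<subseteq> (\<lambda>k. 1 / (2 * \<bar>c n\<bar> * real n) * real k) ` {..n}"
    proof
      fix q assume "q \<in> Psi_hat Xs (c n) n ` space M"
      then obtain \<omega> where q: "q = Psi_hat Xs (c n) n \<omega>"
        by blast
      let ?A = "{i \<in> {1..n}. \<forall>t\<in>{0..1}. Xs i t \<omega> > c n}"
      have "(\<Sum>i=1..n. of_bool (\<forall>t\<in>{0..1}. Xs i t \<omega> > c n)) = real (card ?A)"
        by (simp add: of_bool_def sum.If_cases Int_def conj_commute)
      then have "q = 1 / (2 * \<bar>c n\<bar> * real n) * real (card ?A)"
        by (simp only: q Psi_hat_def)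
      moreover have "card ?A \<le> card {1..n}"
        by (rule card_mono) auto
      ultimately show "q \<in> (\<lambda>k. 1 / (2 * \<bar>c n\<bar> * real n) * real k) ` {..n}"
        by (intro image_eqI) auto
    qed
    then have "finite (Psi_hat Xs (c n) n ` space M)"
      by (rule finite_subset) simp
    then have "simple_function M (Psi_hat Xs (c n) n)"
      by (rule simple_function_borel_measurable[OF Psi_hat_rv])
    then have "simple_function M (\<lambda>\<omega>. g (Psi_hat Xs (c n) n \<omega>))"
      by (rule simple_function_compose1)
    then have [measurable]: "random_variable borel (\<lambda>\<omega>. g (Psi_hat Xs (c n) n \<omega>))"
      by (rule borel_measurable_simple_function)
    have "?T n = (\<lambda>\<omega>. ?R n * (g (Psi_hat Xs (c n) n \<omega>) - \<beta>))"
      by (simp add: beta_hat_def g_def Let_def)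
    then show ?thesis
      by simp
  qed
  \<comment> \<open>Here \<open>y0\<close> is \<open>- \<beta> / 2\<close>, so \<open>2 * y0\<close>
    is the centering \<open>- \<beta>\<close>.\<close>
  have T_conv: "weak_conv_m (\<lambda>n. distr M borel (?T n))
      (normal_law (- (2 * (sqrt \<kappa> * \<mu>)) / \<psi> (- \<beta> / 2)) ((- 2 * s0 / \<psi> (- \<beta> / 2))\<^sup>2))"
    by (rule weak_conv_m_quantile_normal[OF psi Psi_hat_rv T_rv R_lim Z_conv s0(1)])
      (simp add: beta_hat_def Let_def)
  have "(- 2 * s0 / \<psi> (- \<beta> / 2))\<^sup>2 = 2 * ?\<Psi>0 / (\<psi> (- \<beta> / 2))\<^sup>2"
    by (simp add: power_divide power_mult_distrib s0(2))
  then show ?thesis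
    using Z_conv T_conv T_rv unfolding converges_in_distribution_def s0(2)
    by (simp add: mult.assoc)
qed

end
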